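(* Let $(I,\le)$ be an algebraic lattice and denote by $I_0\subseteq I$ the set of compact elements. Let $\kappa$ be the cardinal number $\max\{|I_0|,|\mathbb{N}|\}$. Let $\Lambda$ be any nontrivial countable group. Define $K=\Lambda^{\ast\kappa}$ as the free product of $\kappa$ copies of $\Lambda$. There exists a subgroup $L\leqslant K$ with the following properties. 1. The intermediate subgroup lattice $\{L_1\mid L\leqslant L_1\leqslant K\}$, ordered by inclusion, is isomorphic with $(I,\le)$. 2. Every intermediate subgroup $L\leqslant L_1\leqslant K$ is freely generated by conjugates of the copies of $\Lambda$ in $K$. 3. For every $g\in K$, we have that $g\in L\vee gLg^{-1}$.
   Context: A complete lattice is a partially ordered set in which every subset has an infimum and a supremum. An element $a$ of a complete lattice $(I,\le)$ is compact if whenever $J\subseteq I$ is a nonempty subset with $a\le\sup J$, there is a finite subset $J_0\subseteq J$ with $a\le\sup J_0$. An algebraic lattice is a complete lattice in which every element is the supremum of a set of compact elements. For subgroups $L_1,L_2$ of $K$, $L_1\vee L_2$ denotes the subgroup generated by $L_1\cup L_2$. A group is freely generated by a family of subgroups if it is their (internal) free product. *)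

theory Defs
  imports "HOL-Algebra.Generated_Groups" "HOL-Library.Equipollence" "HOL-Library.Countable_Set"
begin

section \<open>Algebraic lattices\<close>

definition compact_element :: "'i::complete_lattice \<Rightarrow> bool"
  where "compact_element a \<longleftrightarrow>
    (\<forall>J. J \<noteq> {} \<and> a \<le> Sup J \<longrightarrow> (\<exists>J\<^sub>0\<subseteq>J. finite J\<^sub>0 \<and> a \<le> Sup J\<^sub>0))"

definition algebraic_lattice :: "'i::complete_lattice itself \<Rightarrow> bool"
  where "algebraic_lattice _ \<longleftrightarrow> (\<forall>a::'i. \<exists>C. (\<forall>c\<in>C. compact_element c) \<and> a = Sup C)"

definition has_max_card :: "'j set \<Rightarrow> 'a set \<Rightarrow> 'b set \<Rightarrow> bool"
  where "has_max_card J A B \<longleftrightarrow> (J \<approx> A \<and> B \<lesssim> A) \<or> (J \<approx> B \<and> A \<lesssim> B)"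


section \<open>Free products\<close>

text \<open>
  The free product of a family of groups is realised on reduced words: lists of letters
  \<open>(j, x)\<close> with \<open>x\<close> a nontrivial element of the \<open>j\<close>-th group, such that
  neighbouring letters come from different groups. Words are multiplied by concatenation
  followed by reduction; \<open>fp_cons G (j, x) w\<close> is the reduced form of \<open>(j, x) # w\<close>.
\<close>

definition reduced_words :: "'j set \<Rightarrow> ('j \<Rightarrow> ('a, 'b) monoid_scheme) \<Rightarrow> ('j \<times> 'a) list set"
  where "reduced_words J G =
    {w. (\<forall>(j, x)\<in>set w. j \<in> J \<and> x \<in> carrier (G j) \<and> x \<noteq> \<one>\<^bsub>G j\<^esub>) \<and> distinct_adj (map fst w)}"

definition fp_push :: "('j \<Rightarrow> ('a, 'b) monoid_scheme) \<Rightarrow> 'j \<Rightarrow> 'a \<Rightarrow> ('j \<times> 'a) list \<Rightarrow> ('j \<times> 'a) list"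
  where "fp_push G j x w = (if x = \<one>\<^bsub>G j\<^esub> then w else (j, x) # w)"

fun fp_cons :: "('j \<Rightarrow> ('a, 'b) monoid_scheme) \<Rightarrow> 'j \<times> 'a \<Rightarrow> ('j \<times> 'a) list \<Rightarrow> ('j \<times> 'a) list"
  where
    "fp_cons G (j, x) [] = fp_push G j x []"
  | "fp_cons G (j, x) ((k, y) # w) =
       (if j = k then fp_push G j (x \<otimes>\<^bsub>G j\<^esub> y) w else fp_push G j x ((k, y) # w))"

definition free_product :: "'j set \<Rightarrow> ('j \<Rightarrow> ('a, 'b) monoid_scheme) \<Rightarrow> ('j \<times> 'a) list monoid"
  where "free_product J G =
    \<lparr>carrier = reduced_words J G, monoid.mult = foldr (fp_cons G), one = []\<rparr>"

definition fp_factor :: "('j \<Rightarrow> ('a, 'b) monoid_scheme) \<Rightarrow> 'j \<Rightarrow> ('j \<times> 'a) list set"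
  where "fp_factor G j = (\<lambda>x. fp_push G j x []) ` carrier (G j)"

text \<open>
  A group is freely generated by a family of subgroups (it is their internal free product) iff
  the canonical map from the free product of the family, which evaluates words in the group,
  is an isomorphism.
\<close>

definition freely_generated_by ::
    "('a, 'b) monoid_scheme \<Rightarrow> 't set \<Rightarrow> ('t \<Rightarrow> 'a set) \<Rightarrow> bool"
  where "freely_generated_by G T H \<longleftrightarrow>
    (\<forall>t\<in>T. subgroup (H t) G) \<and>
    (\<lambda>w. foldr (\<lambda>(t, x) y. x \<otimes>\<^bsub>G\<^esub> y) w \<one>\<^bsub>G\<^esub>)
      \<in> iso (free_product T (\<lambda>t. G\<lparr>carrier := H t\<rparr>)) G"

definition conjugate_set :: "('a, 'b) monoid_scheme \<Rightarrow> 'a \<Rightarrow> 'a set \<Rightarrow> 'a set"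
  where "conjugate_set G g H = (g <#\<^bsub>G\<^esub> H) #>\<^bsub>G\<^esub> inv\<^bsub>G\<^esub> g"

definition intermediate_subgroups :: "('a, 'b) monoid_scheme \<Rightarrow> 'a set \<Rightarrow> 'a set set"
  where "intermediate_subgroups G L = {L\<^sub>1. subgroup L\<^sub>1 G \<and> L \<subseteq> L\<^sub>1}"


section \<open>Free products are groups, freely generated by their factors\<close>

lemma reduced_words_Nil [simp]: "[] \<in> reduced_words J G"
  by (simp add: reduced_words_def)

lemma reduced_words_Cons:
  "(j, x) # w \<in> reduced_words J G \<longleftrightarrow>
     j \<in> J \<and> x \<in> carrier (G j) \<and> x \<noteq> \<one>\<^bsub>G j\<^esub> \<and> w \<in> reduced_words J G \<and> (w = [] \<or> fst (hd w) \<noteq> j)"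
  by (cases w) (auto simp: reduced_words_def)

lemma fp_cons_reduced:
  assumes "group (G j)" "j \<in> J" "x \<in> carrier (G j)" "w \<in> reduced_words J G"
  shows "fp_cons G (j, x) w \<in> reduced_words J G"
proof -
  interpret group "G j" by fact
  show ?thesis
  proof (cases w)
    case Nil
    then show ?thesis using assms by (auto simp: fp_push_def reduced_words_Cons)
  next
    case (Cons l v)
    then show ?thesis using assms
      by (cases l) (auto simp: fp_push_def reduced_words_Cons)
  qed
qed

lemma fp_cons_one:
  assumes "group (G j)" "w \<in> reduced_words J G"
  shows "fp_cons G (j, \<one>\<^bsub>G j\<^esub>) w = w"
proof -
  interpret group "G j" by fact
  show ?thesis
    using assms(2) by (cases w) (auto simp: fp_push_def reduced_words_Cons)
qed

lemma fp_cons_Cons: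
  assumes "(j, x) # w \<in> reduced_words J G"
  shows "fp_cons G (j, x) w = (j, x) # w"
  using assms by (cases w) (auto simp: fp_push_def reduced_words_Cons)

lemma fp_cons_fp_cons:
  assumes "group (G j)" "x \<in> carrier (G j)" "y \<in> carrier (G j)" "w \<in> reduced_words J G"
  shows "fp_cons G (j, x) (fp_cons G (j, y) w) = fp_cons G (j, x \<otimes>\<^bsub>G j\<^esub> y) w"
proof -
  interpret group "G j" by fact
  show ?thesis
  proof (cases w)
    case Nil
    then show ?thesis using assms by (auto simp: fp_push_def)
  next
    case (Cons l v)
    obtain k z where l: "l = (k, z)" by (cases l)
    have v: "v = [] \<or> fst (hd v) \<noteq> k" "v \<in> reduced_words J G" "z \<in> carrier (G k)"
      using assms(4) Cons l by (auto simp: reduced_words_Cons)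
    show ?thesis
    proof (cases "k = j")
      case True
      have *: "fp_cons G (j, x) v = fp_push G j x v"
        using v True by (cases v) auto
      show ?thesis
      proof (cases "y \<otimes>\<^bsub>G j\<^esub> z = \<one>\<^bsub>G j\<^esub>")
        case yz: True
        have "x \<otimes>\<^bsub>G j\<^esub> y \<otimes>\<^bsub>G j\<^esub> z = x"
          using assms v True yz by (simp add: m_assoc)
        then show ?thesis
          using Cons l True yz * by (simp add: fp_push_def)
      next
        case False
        then show ?thesis
          using assms v Cons l True by (simp add: fp_push_def m_assoc)
      qed
    next
      case False
      then show ?thesis
        using assms Cons l by (auto simp: fp_push_def)
    qed
  qed
qed

context
  fixes J :: "'j set" and G :: "'j \<Rightarrow> ('a, 'b) monoid_scheme"
  assumes groups: "\<And>j. j \<in> J \<Longrightarrow> group (G j)"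
begin

lemma fp_mult_closed:
  assumes "u \<in> reduced_words J G" "w \<in> reduced_words J G"
  shows "foldr (fp_cons G) u w \<in> reduced_words J G"
  using assms
proof (induction u)
  case (Cons l u)
  then show ?case by (cases l) (auto simp: reduced_words_Cons intro!: fp_cons_reduced groups)
qed simp

lemma fp_mult_Nil:
  assumes "u \<in> reduced_words J G"
  shows "foldr (fp_cons G) u [] = u"
  using assms
proof (induction u)
  case (Cons l u)
  then show ?case by (cases l) (auto simp: reduced_words_Cons fp_cons_Cons[where J = J])
qed simp

lemma fp_mult_fp_cons:
  assumes "j \<in> J" "x \<in> carrier (G j)" "u \<in> reduced_words J G" "w \<in> reduced_words J G"
  shows "foldr (fp_cons G) (fp_cons G (j, x) u) w = fp_cons G (j, x) (foldr (fp_cons G) u w)"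
proof -
  note gr = groups[OF assms(1)]
  have push: "foldr (fp_cons G) (fp_push G j y v) w = fp_cons G (j, y) (foldr (fp_cons G) v w)"
    if "v \<in> reduced_words J G" for y v
    using fp_cons_one[OF gr fp_mult_closed[OF that assms(4)]] by (simp add: fp_push_def)
  show ?thesis
  proof (cases u)
    case Nil
    then show ?thesis using push[of "[]"] by simp
  next
    case (Cons l v)
    obtain k z where l: "l = (k, z)" by (cases l)
    have v: "v \<in> reduced_words J G" "z \<in> carrier (G k)"
      using assms(3) Cons l by (auto simp: reduced_words_Cons)
    show ?thesis
    proof (cases "k = j")
      case True
      then show ?thesis
        using fp_cons_fp_cons[of G, OF gr assms(2) _ fp_mult_closed[OF v(1) assms(4)]] v push Cons l
        by simp
    next
      case False
      then show ?thesis
        using push[of "(k, z) # v"] assms(3) Cons l by simp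
    qed
  qed
qed

lemma fp_mult_assoc:
  assumes "u \<in> reduced_words J G" "v \<in> reduced_words J G" "w \<in> reduced_words J G"
  shows "foldr (fp_cons G) (foldr (fp_cons G) u v) w = foldr (fp_cons G) u (foldr (fp_cons G) v w)"
  using assms(1)
proof (induction u)
  case (Cons l u)
  obtain j x where l: "l = (j, x)" by (cases l)
  have u: "j \<in> J" "x \<in> carrier (G j)" "u \<in> reduced_words J G"
    using Cons.prems l by (auto simp: reduced_words_Cons)
  then show ?case
    using fp_mult_fp_cons[OF u(1,2) fp_mult_closed[OF u(3) assms(2)] assms(3)] Cons.IH l by simp
qed simp

lemma fp_left_inverse:
  assumes "u \<in> reduced_words J G"
  shows "\<exists>v\<in>reduced_words J G. foldr (fp_cons G) v u = []"
  using assms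
proof (induction u)
  case (Cons l u)
  obtain j x where l: "l = (j, x)" by (cases l)
  have u: "j \<in> J" "x \<in> carrier (G j)" "u \<in> reduced_words J G" "(j, x) # u \<in> reduced_words J G"
    using Cons.prems l by (auto simp: reduced_words_Cons)
  interpret j: group "G j" using groups u by blast
  obtain v where v: "v \<in> reduced_words J G" "foldr (fp_cons G) v u = []"
    using Cons.IH u by blast
  let ?i = "fp_cons G (j, inv\<^bsub>G j\<^esub> x) []"
  have i: "?i \<in> reduced_words J G"
    using u by (intro fp_cons_reduced j.is_group) auto
  have "foldr (fp_cons G) ?i ((j, x) # u) = fp_cons G (j, inv\<^bsub>G j\<^esub> x) ((j, x) # u)"
    using fp_mult_fp_cons[of j "inv\<^bsub>G j\<^esub> x" "[]" "(j, x) # u"] u by simp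
  also have "\<dots> = u"
    using u by (simp add: fp_push_def)
  finally have *: "foldr (fp_cons G) ?i ((j, x) # u) = u" .
  have "foldr (fp_cons G) (foldr (fp_cons G) v ?i) ((j, x) # u) = []"
    unfolding fp_mult_assoc[OF v(1) i u(4)] * by (fact v(2))
  then show ?case using fp_mult_closed[OF v(1) i] l by blast
qed (rule bexI[of _ "[]"], auto)

lemma group_free_product: "group (free_product J G)"
proof (rule groupI)
  show "\<exists>y\<in>carrier (free_product J G). y \<otimes>\<^bsub>free_product J G\<^esub> x = \<one>\<^bsub>free_product J G\<^esub>"
    if "x \<in> carrier (free_product J G)" for x
    using that fp_left_inverse[of x] by (simp add: free_product_def)
qed (simp_all add: free_product_def fp_mult_closed fp_mult_assoc)

end

text \<open>Words over subgroups of a common group evaluate homomorphically.\<close>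

lemma (in group) fp_eval_hom:
  assumes H: "\<And>t. t \<in> T \<Longrightarrow> subgroup (H t) G"
  shows "(\<lambda>w. foldr (\<lambda>(t, x) y. x \<otimes> y) w \<one>) \<in> hom (free_product T (\<lambda>t. G\<lparr>carrier := H t\<rparr>)) G"
    (is "?e \<in> hom (free_product T ?G) G")
proof -
  have groups: "group (?G t)" if "t \<in> T" for t
    using H[OF that] by (simp add: subgroup.subgroup_is_group is_group)
  have closed: "?e w \<in> carrier G" if "w \<in> reduced_words T ?G" for w
    using that
  proof (induction w)
    case (Cons l w)
    then show ?case
      by (cases l) (auto simp: reduced_words_Cons intro!: m_closed dest: subgroup.mem_carrier[OF H])
  qed simp
  have cons: "?e (fp_cons ?G (t, x) w) = x \<otimes> ?e w"
    if "t \<in> T" "x \<in> H t" "w \<in> reduced_words T ?G" for t x w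
  proof -
    have x: "x \<in> carrier G" using that H by (meson subgroup.mem_carrier)
    show ?thesis
    proof (cases w)
      case Nil
      then show ?thesis using x by (simp add: fp_push_def)
    next
      case (Cons l v)
      obtain k z where l: "l = (k, z)" by (cases l)
      have v: "v \<in> reduced_words T ?G" "z \<in> carrier G"
        using that Cons l H by (auto simp: reduced_words_Cons dest: subgroup.mem_carrier)
      have ev: "?e v \<in> carrier G" using closed[OF v(1)] .
      have w: "?e w = z \<otimes> ?e v" using Cons l by simp
      have push: "?e (fp_push ?G t y u) = y \<otimes> ?e u" if "?e u \<in> carrier G" for y u
        using that by (simp add: fp_push_def)
      show ?thesis
      proof (cases "t = k")
        case True
        then have "fp_cons ?G (t, x) w = fp_push ?G t (x \<otimes> z) v" using Cons l by simp
        then show ?thesis unfolding w using push[OF ev] m_assoc[OF x v(2) ev] by simp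
      next
        case False
        then have "fp_cons ?G (t, x) w = fp_push ?G t x w" using Cons l by simp
        moreover have "?e w \<in> carrier G" unfolding w using v(2) ev by (rule m_closed)
        ultimately show ?thesis using push by simp
      qed
    qed
  qed
  show ?thesis
  proof (rule homI)
    fix u w assume uw: "u \<in> carrier (free_product T ?G)" "w \<in> carrier (free_product T ?G)"
    then have u: "u \<in> reduced_words T ?G" and w: "w \<in> reduced_words T ?G"
      by (simp_all add: free_product_def)
    from u show "?e (u \<otimes>\<^bsub>free_product T ?G\<^esub> w) = ?e u \<otimes> ?e w"
    proof (induction u)
      case Nil
      then show ?case using closed[OF w] by (simp add: free_product_def)
    next
      case (Cons l u)
      obtain t x where l: "l = (t, x)" by (cases l)
      have u: "t \<in> T" "x \<in> H t" "u \<in> reduced_words T ?G"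
        using Cons.prems l by (auto simp: reduced_words_Cons)
      have x: "x \<in> carrier G" using u H by (meson subgroup.mem_carrier)
      show ?case
        using cons[OF u(1,2) fp_mult_closed[of T ?G, OF groups u(3) w]] Cons.IH[OF u(3)]
          m_assoc[OF x closed[OF u(3)] closed[OF w]] l
        by (simp add: free_product_def)
    qed
  qed (use closed in \<open>auto simp: free_product_def\<close>)
qed

lemma fp_factor_subgroup:
  assumes groups: "\<And>j. j \<in> J \<Longrightarrow> group (G j)" and j: "j \<in> J"
  shows "subgroup (fp_factor G j) (free_product J G)"
proof -
  interpret K: group "free_product J G" by (rule group_free_product) (rule groups)
  interpret j: group "G j" using groups j by blast
  interpret h: group_hom "G j" "free_product J G" "\<lambda>x. fp_push G j x []"
  proof unfold_locales
    show "(\<lambda>x. fp_push G j x []) \<in> hom (G j) (free_product J G)"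
    proof (rule homI)
      fix x y assume xy: "x \<in> carrier (G j)" "y \<in> carrier (G j)"
      show "fp_push G j (x \<otimes>\<^bsub>G j\<^esub> y) [] =
          fp_push G j x [] \<otimes>\<^bsub>free_product J G\<^esub> fp_push G j y []"
        using xy by (auto simp: free_product_def fp_push_def)
    qed (use j in \<open>auto simp: free_product_def fp_push_def reduced_words_Cons\<close>)
  qed
  show ?thesis
    unfolding fp_factor_def using h.img_is_subgroup .
qed

lemma free_product_freely_generated:
  assumes groups: "\<And>j. j \<in> J \<Longrightarrow> group (G j)"
  shows "freely_generated_by (free_product J G) J (fp_factor G)"
proof -
  define K where "K = free_product J G"
  let ?F = "\<lambda>j. K\<lparr>carrier := fp_factor G j\<rparr>"
  let ?e = "\<lambda>w. foldr (\<lambda>(t, x) y. x \<otimes>\<^bsub>K\<^esub> y) w \<one>\<^bsub>K\<^esub>"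
  let ?d = "map (\<lambda>(j, x). (j, [(j, x)]))"
  interpret K: group K unfolding K_def by (rule group_free_product) (rule groups)
  have sub: "subgroup (fp_factor G j) K" if "j \<in> J" for j
    unfolding K_def using fp_factor_subgroup[OF groups that] .
  have one: "\<one>\<^bsub>K\<^esub> = []" by (simp add: K_def free_product_def)
  have d: "?d w \<in> reduced_words J ?F \<and> ?e (?d w) = w" if "w \<in> reduced_words J G" for w
    using that
  proof (induction w)
    case (Cons l w)
    obtain j x where l: "l = (j, x)" by (cases l)
    have w: "j \<in> J" "x \<in> carrier (G j)" "x \<noteq> \<one>\<^bsub>G j\<^esub>" "w \<in> reduced_words J G"
      "w = [] \<or> fst (hd w) \<noteq> j"
      using Cons.prems l by (auto simp: reduced_words_Cons)
    have "[(j, x)] \<in> fp_factor G j"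
      using w by (auto simp: fp_factor_def fp_push_def intro!: image_eqI[of _ _ x])
    moreover have "?d w = [] \<or> fst (hd (?d w)) \<noteq> j"
      using w by (cases w) auto
    moreover have "[(j, x)] \<otimes>\<^bsub>K\<^esub> w = (j, x) # w"
      using fp_cons_Cons[of j x w J G] Cons.prems l by (simp add: K_def free_product_def)
    ultimately show ?case
      using Cons.IH[OF w(4)] w l one by (simp add: reduced_words_Cons)
  qed (simp add: one)
  have surj: "\<exists>v\<in>reduced_words J G. u = ?d v" if "u \<in> reduced_words J ?F" for u
    using that
  proof (induction u)
    case (Cons l u)
    obtain j y where l: "l = (j, y)" by (cases l)
    have u: "j \<in> J" "y \<in> fp_factor G j" "y \<noteq> []" "u \<in> reduced_words J ?F"
      "u = [] \<or> fst (hd u) \<noteq> j"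
      using Cons.prems l one by (auto simp: reduced_words_Cons)
    obtain x where x: "x \<in> carrier (G j)" "x \<noteq> \<one>\<^bsub>G j\<^esub>" "y = [(j, x)]"
      using u(2,3) by (auto simp: fp_factor_def fp_push_def split: if_splits)
    obtain v where v: "v \<in> reduced_words J G" "u = ?d v"
      using Cons.IH u by blast
    have "v = [] \<or> fst (hd v) \<noteq> j"
      using u(5) v(2) by (cases v) auto
    then show ?case
      using u x v l by (intro bexI[of _ "(j, x) # v"]) (auto simp: reduced_words_Cons)
  qed simp
  have "bij_betw ?e (reduced_words J ?F) (reduced_words J G)"
    by (rule bij_betw_byWitness[where f' = ?d]) (use d surj in fastforce)+
  moreover have "?e \<in> hom (free_product J ?F) K"
    using K.fp_eval_hom sub by blast
  ultimately have "?e \<in> iso (free_product J ?F) K"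
    by (simp add: iso_def K_def free_product_def)
  then show ?thesis
    using sub unfolding freely_generated_by_def K_def by blast
qed

end

theory Submission
  imports Defs
begin

text \<open>
  Every letter (copy of \<open>\<Lambda>\<close>) \<open>j\<close> gets a label \<open>c j\<close>, a compact element of \<open>I\<close>, and \<open>L\<close> is
  built together with subgroups \<open>K\<^sub>a \<supseteq> L\<close>, one for each \<open>a \<in> I\<close>, such that every
  \<open>w \<in> K\<close> has a least \<open>a\<close> with \<open>w \<in> K\<^sub>a\<close>, and this element \<open>c w\<close> is compact. For
  the \<open>K\<^sub>a\<close> to be the only intermediate subgroups, a word \<open>g\<close> together with \<open>L\<close> has to generate
  every copy \<open>\<Lambda>\<^sub>b\<close> with \<open>c b \<le> c g\<close>. This is forced by adding two new copies \<open>\<Lambda>\<^sub>t\<close>,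
  \<open>\<Lambda>\<^sub>p\<close> to \<open>L\<close>, as well as the conjugate of \<open>\<Lambda>\<^sub>b\<close> by \<open>g\<^sup>-\<^sup>1 \<sigma>\<^sub>t g \<sigma>\<^sub>p\<close>, where
  \<open>\<sigma>\<close> is a fixed nontrivial element of \<open>\<Lambda>\<close>: all factors of this conjugator except \<open>g\<close> lie in
  \<open>L\<close>. As \<open>t\<close> and \<open>p\<close> are new, the normal form of a product of generators of \<open>K\<^sub>a\<close> can be
  read off from the factors; this gives the free bases and the elements \<open>c w\<close>. Treating all
  pairs \<open>(g, b)\<close> takes countably many levels, and \<open>\<kappa>\<close> is infinite, so that there are enough
  letters.
\<close>

section \<open>Compact elements, conjugates and cardinalities\<close>

lemma infinite_times_lepoll_self:
  assumes "infinite A" "B \<lesssim> A"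
  shows "B \<times> A \<lesssim> A"
proof -
  have "A \<times> A \<approx> A"
    unfolding eqpoll_iff_card_of_ordIso by (rule card_of_Times_same_infinite[OF assms(1)])
  then show ?thesis by (rule lepoll_trans2[OF times_lepoll_mono[OF assms(2) lepoll_refl]])
qed

lemma lists_lepoll_infinite:
  assumes "infinite A"
  shows "lists A \<lesssim> A"
proof -
  let ?L = "\<lambda>n. {xs \<in> lists A. length xs = n}"
  have L: "?L n \<lesssim> A" for n
  proof (induction n)
    case 0
    have "?L 0 = {[]}" by auto
    then show ?case using assms by (simp add: finite_lepoll_infinite)
  next
    case (Suc n)
    have "?L (Suc n) \<subseteq> (\<lambda>(xs, x). x # xs) ` (?L n \<times> A)"
    proof
      fix xs assume "xs \<in> ?L (Suc n)"
      then show "xs \<in> (\<lambda>(xs, x). x # xs) ` (?L n \<times> A)"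
        by (cases xs) (auto intro: image_eqI[of _ _ "(tl xs, hd xs)"])
    qed
    then have "?L (Suc n) \<lesssim> ?L n \<times> A" by (rule subset_image_lepoll)
    also have "\<dots> \<lesssim> A" by (rule infinite_times_lepoll_self[OF assms Suc])
    finally show ?case .
  qed
  have "\<forall>n. \<exists>f. inj_on f (?L n) \<and> f ` ?L n \<subseteq> A"
    using L unfolding lepoll_def by (rule allI)
  from choice[OF this] obtain f where "\<forall>n. inj_on (f n) (?L n) \<and> f n ` ?L n \<subseteq> A" ..
  then have f: "inj_on (f n) (?L n)" "f n ` ?L n \<subseteq> A" for n by simp_all
  have "inj_on (\<lambda>xs. (length xs, f (length xs) xs)) (lists A)"
  proof (rule inj_onI)
    fix xs ys assume "xs \<in> lists A" "ys \<in> lists A"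
      "(length xs, f (length xs) xs) = (length ys, f (length ys) ys)"
    then show "xs = ys" by (intro inj_onD[OF f(1)[of "length ys"]]) auto
  qed
  moreover have "(\<lambda>xs. (length xs, f (length xs) xs)) ` lists A \<subseteq> UNIV \<times> A"
    using f(2) by auto
  ultimately have "lists A \<lesssim> (UNIV :: nat set) \<times> A" unfolding lepoll_def by (intro exI conjI)
  also have "\<dots> \<lesssim> A"
    by (rule infinite_times_lepoll_self[OF assms]) (use assms in \<open>simp add: infinite_le_lepoll\<close>)
  finally show ?thesis .
qed

text \<open>Countability of \<open>\<Lambda>\<close> enters here. The bound lets \<open>J\<close>
  index all pairs of a word of \<open>K\<close> and a letter.\<close>

lemma reduced_words_lepoll:
  assumes "infinite J" "countable (carrier \<Lambda>)"
  shows "reduced_words J (\<lambda>_. \<Lambda>) \<lesssim> J"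
proof -
  have "carrier \<Lambda> \<lesssim> (UNIV :: nat set)"
    using assms(2) by (auto simp: countable_def lepoll_def)
  also have "\<dots> \<lesssim> J" using assms(1) by (simp add: infinite_le_lepoll)
  finally have "carrier \<Lambda> \<times> J \<lesssim> J" by (rule infinite_times_lepoll_self[OF assms(1)])
  then have "J \<times> carrier \<Lambda> \<lesssim> J" by (rule lepoll_trans1[OF times_commute_eqpoll])
  then have "lists (J \<times> carrier \<Lambda>) \<lesssim> lists J" by (rule lists_lepoll_mono)
  also have "\<dots> \<lesssim> J" by (rule lists_lepoll_infinite[OF assms(1)])
  finally have "lists (J \<times> carrier \<Lambda>) \<lesssim> J" .
  moreover have "reduced_words J (\<lambda>_. \<Lambda>) \<subseteq> lists (J \<times> carrier \<Lambda>)"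
    by (auto simp: reduced_words_def)
  ultimately show ?thesis by (rule lepoll_trans[OF subset_imp_lepoll, rotated])
qed

lemma has_max_card_nat:
  assumes "has_max_card J A (UNIV :: nat set)"
  shows "infinite J" "A \<lesssim> J"
proof -
  have "(UNIV :: nat set) \<lesssim> J \<and> A \<lesssim> J"
    using assms unfolding has_max_card_def
    by (meson eqpoll_imp_lepoll eqpoll_sym lepoll_trans)
  then show "infinite J" "A \<lesssim> J" by (auto simp: infinite_le_lepoll)
qed

lemma compact_element_bot: "compact_element (bot :: 'i::complete_lattice)"
  unfolding compact_element_def by (metis bot_least empty_subsetI finite.emptyI)

text \<open>Labels of words arise as finite joins of labels of letters, so compactness has to pass
  to joins.\<close>

lemma compact_element_sup:
  fixes x y :: "'i::complete_lattice"
  assumes "compact_element x" "compact_element y"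
  shows "compact_element (sup x y)"
  unfolding compact_element_def
proof (intro allI impI)
  fix S :: "'i set" assume S: "S \<noteq> {} \<and> sup x y \<le> Sup S"
  then have "x \<le> Sup S" "y \<le> Sup S"
    using order_trans[OF sup_ge1] order_trans[OF sup_ge2] by blast+
  then obtain A B where "A \<subseteq> S" "finite A" "x \<le> Sup A" "B \<subseteq> S" "finite B" "y \<le> Sup B"
    using assms S unfolding compact_element_def by meson
  then show "\<exists>S\<^sub>0\<subseteq>S. finite S\<^sub>0 \<and> sup x y \<le> Sup S\<^sub>0"
    by (intro exI[of _ "A \<union> B"]) (auto simp: Sup_union_distrib intro: le_supI1 le_supI2)
qed

lemma conjugate_set_image: "conjugate_set G x H = (\<lambda>h. x \<otimes>\<^bsub>G\<^esub> h \<otimes>\<^bsub>G\<^esub> inv\<^bsub>G\<^esub> x) ` H"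
  by (auto simp: conjugate_set_def l_coset_def r_coset_def)

lemma (in group) subgroup_conjugate_set:
  assumes x: "x \<in> carrier G" and H: "subgroup H G"
  shows "subgroup (conjugate_set G x H) G"
proof (rule subgroupI)
  note mem = subgroup.mem_carrier[OF H]
  show "conjugate_set G x H \<subseteq> carrier G"
    using x by (auto simp: conjugate_set_image mem)
  show "conjugate_set G x H \<noteq> {}"
    using subgroup.one_closed[OF H] by (auto simp: conjugate_set_image)
  fix y assume "y \<in> conjugate_set G x H"
  then obtain h where h: "h \<in> H" "y = x \<otimes> h \<otimes> inv x" by (auto simp: conjugate_set_image)
  have "inv y = x \<otimes> inv h \<otimes> inv x"
    using x h mem by (simp add: inv_mult_group m_assoc)
  then show "inv y \<in> conjugate_set G x H"
    using subgroup.m_inv_closed[OF H h(1)] by (auto simp: conjugate_set_image)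
  fix z assume "z \<in> conjugate_set G x H"
  then obtain k where k: "k \<in> H" "z = x \<otimes> k \<otimes> inv x" by (auto simp: conjugate_set_image)
  have "y \<otimes> z = x \<otimes> (h \<otimes> k) \<otimes> inv x"
    using x h k mem by (simp add: m_assoc) (simp add: m_assoc[symmetric])
  then show "y \<otimes> z \<in> conjugate_set G x H"
    using subgroup.m_closed[OF H h(1) k(1)] by (auto simp: conjugate_set_image)
qed

section \<open>Reduced words\<close>

lemma reduced_words_append:
  "u @ w \<in> reduced_words J G \<longleftrightarrow> u \<in> reduced_words J G \<and> w \<in> reduced_words J G \<and>
     (u = [] \<or> w = [] \<or> fst (last u) \<noteq> fst (hd w))"
  by (auto simp: reduced_words_def distinct_adj_append_iff last_map hd_map)

lemma reduced_words_mono: "I \<subseteq> J \<Longrightarrow> reduced_words I G \<subseteq> reduced_words J G"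
  by (auto simp: reduced_words_def)

lemma fp_mult_append:
  assumes "u @ w \<in> reduced_words J G"
  shows "foldr (fp_cons G) u w = u @ w"
  using assms
proof (induction u)
  case (Cons l u)
  then show ?case
    by (cases l) (auto simp: reduced_words_Cons intro!: fp_cons_Cons[where J = J])
qed simp

text \<open>The letters of \<open>u\<close> are multiplied in one at a time, and each can merge only
  with the first letter standing there. Even if all of \<open>w\<close> has cancelled, that letter
  is the head of \<open>v\<close>, which belongs to a different factor.\<close>

lemma fp_mult_append_right:
  assumes "\<forall>l\<in>set u. v = [] \<or> fst l \<noteq> fst (hd v)"
  shows "foldr (fp_cons G) u (w @ v) = foldr (fp_cons G) u w @ v"
  using assms
proof (induction u)
  case (Cons l u)
  obtain j x where l: "l = (j, x)" by (cases l)
  have "fp_cons G (j, x) (y @ v) = fp_cons G (j, x) y @ v" for y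
    using Cons.prems l by (cases y; cases v) (auto simp: fp_push_def)
  then show ?case using Cons l by simp
qed simp

lemma subgroup_reduced_words:
  assumes groups: "\<And>j. j \<in> J \<Longrightarrow> group (G j)" and "I \<subseteq> J"
  shows "subgroup (reduced_words I G) (free_product J G)"
proof -
  interpret K: group "free_product J G" by (rule group_free_product) (rule groups)
  have gr: "\<And>j. j \<in> I \<Longrightarrow> group (G j)" using assms by blast
  note sub = subsetD[OF reduced_words_mono[OF \<open>I \<subseteq> J\<close>]]
  show ?thesis
  proof (rule K.subgroupI)
    fix u assume u: "u \<in> reduced_words I G"
    obtain v where v: "v \<in> reduced_words I G" "foldr (fp_cons G) v u = []"
      using fp_left_inverse[of I G, OF gr u] by blast
    then have "inv\<^bsub>free_product J G\<^esub> u = v"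
      by (intro K.inv_equality) (auto simp: free_product_def intro: sub u)
    then show "inv\<^bsub>free_product J G\<^esub> u \<in> reduced_words I G" using v by simp
    fix w assume "w \<in> reduced_words I G"
    then show "u \<otimes>\<^bsub>free_product J G\<^esub> w \<in> reduced_words I G"
      using fp_mult_closed[of I G, OF gr u] by (simp add: free_product_def)
  next
    show "reduced_words I G \<noteq> {}" using reduced_words_Nil by blast
  qed (use sub in \<open>auto simp: free_product_def\<close>)
qed

lemma append_eq_append_split:
  assumes "u @ v = u' @ v'"
    and "\<forall>x\<in>set u. P x" "\<forall>x\<in>set u'. P x" "v = [] \<or> \<not> P (hd v)" "v' = [] \<or> \<not> P (hd v')"
  shows "u = u' \<and> v = v'"
proof -
  have *: "takeWhile P (u @ v) = u" if "\<forall>x\<in>set u. P x" "v = [] \<or> \<not> P (hd v)" for u v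
    using that by (cases v) (auto simp: takeWhile_append)
  show ?thesis using *[of u v] *[of u' v'] assms by auto
qed

text \<open>Passes from an indexed family to the set of its members, the form in which the theorem
  speaks of conjugates. No two indices share a subgroup: a nontrivial \<open>s\<close> in
  \<open>H t = H t'\<close> would give the reduced word \<open>s, inv s\<close> of value one,
  against the trivial kernel.\<close>

lemma (in group) freely_generated_by_image:
  fixes H :: "'t \<Rightarrow> 'a set"
  defines "eval_word \<equiv> \<lambda>w. foldr (\<lambda>(t, x) y. x \<otimes> y) w \<one>"
  assumes sub: "\<And>t. t \<in> X \<Longrightarrow> subgroup (H t) G"
    and nontriv: "\<And>t. t \<in> X \<Longrightarrow> H t \<noteq> {\<one>}"
    and ker: "\<And>w. w \<in> reduced_words X (\<lambda>t. G\<lparr>carrier := H t\<rparr>) \<Longrightarrow> eval_word w = \<one> \<Longrightarrow> w = []"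
    and img: "eval_word ` reduced_words X (\<lambda>t. G\<lparr>carrier := H t\<rparr>) = L"
    and L: "subgroup L G"
  shows "freely_generated_by (G\<lparr>carrier := L\<rparr>) (H ` X) (\<lambda>A. A)"
proof -
  define eval_word' :: "('a set \<times> 'a) list \<Rightarrow> 'a" where "eval_word' = (\<lambda>w. foldr (\<lambda>(t, x) y. x \<otimes> y) w \<one>)"
  let ?R = "reduced_words X (\<lambda>t. G\<lparr>carrier := H t\<rparr>)"
  let ?R' = "reduced_words (H ` X) (\<lambda>A. G\<lparr>carrier := A\<rparr>)"
  have HL: "H t \<subseteq> L" if "t \<in> X" for t
  proof
    fix s assume s: "s \<in> H t"
    show "s \<in> L"
    proof (cases "s = \<one>")
      case True
      then show ?thesis using subgroup.one_closed[OF L] by simp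
    next
      case False
      have "s \<in> carrier G" using subgroup.mem_carrier[OF sub[OF that] s] .
      then have "eval_word [(t, s)] = s" by (simp add: eval_word_def)
      moreover have "[(t, s)] \<in> ?R" using s that False by (simp add: reduced_words_Cons)
      ultimately show ?thesis using img by force
    qed
  qed
  have inj: "inj_on H X"
  proof (rule inj_onI, rule ccontr)
    fix t t' assume t: "t \<in> X" "t' \<in> X" "H t = H t'" "t \<noteq> t'"
    obtain s where s: "s \<in> H t" "s \<noteq> \<one>"
      using nontriv[OF t(1)] subgroup.one_closed[OF sub[OF t(1)]] by blast
    have "s \<in> carrier G" using subgroup.mem_carrier[OF sub[OF t(1)] s(1)] .
    moreover have "inv s \<in> H t'" using subgroup.m_inv_closed[OF sub[OF t(1)] s(1)] t(3) by simp
    ultimately have "[(t, s), (t', inv s)] \<in> ?R" "eval_word [(t, s), (t', inv s)] = \<one>"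
      using s t by (auto simp: reduced_words_Cons eval_word_def inv_eq_1_iff)
    then show False using ker by blast
  qed
  have unmap: "\<exists>v\<in>?R. w = map (map_prod H id) v" if "w \<in> ?R'" for w
  proof
    let ?v = "map (map_prod (inv_into X H) id) w"
    have "\<forall>l\<in>set w. fst l \<in> H ` X" using that by (auto simp: reduced_words_def)
    then show "w = map (map_prod H id) ?v"
      by (induction w) (auto simp: f_inv_into_f)
    have "inj_on (inv_into X H) (set (map fst w))"
      using that by (intro inj_on_subset[OF inj_on_inv_into[of "H ` X"]]) (auto simp: reduced_words_def)
    then have "distinct_adj (map (inv_into X H) (map fst w))"
      by (rule distinct_adj_mapI[rotated]) (use that in \<open>simp add: reduced_words_def\<close>)
    moreover have "map (inv_into X H) (map fst w) = map fst ?v" by simp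
    moreover have "inv_into X H A \<in> X \<and> s \<in> H (inv_into X H A) \<and> s \<noteq> \<one>" if "(A, s) \<in> set w" for A s
      using \<open>w \<in> ?R'\<close> that by (auto simp: reduced_words_def f_inv_into_f inv_into_into)
    ultimately show "?v \<in> ?R"
      by (auto simp: reduced_words_def)
  qed
  have remap: "map (map_prod H id) v \<in> ?R'" if "v \<in> ?R" for v
  proof -
    have "inj_on H (set (map fst v))"
      using that by (intro inj_on_subset[OF inj]) (auto simp: reduced_words_def)
    then have "distinct_adj (map H (map fst v))"
      by (rule distinct_adj_mapI[rotated]) (use that in \<open>simp add: reduced_words_def\<close>)
    moreover have "map H (map fst v) = map fst (map (map_prod H id) v)" by simp
    ultimately show ?thesis using that by (auto simp: reduced_words_def)
  qed
  have eval_word_map: "eval_word' (map (map_prod H id) v) = eval_word v" for v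
    by (induction v) (auto simp: eval_word'_def eval_word_def)
  have R': "?R' = map (map_prod H id) ` ?R" using unmap remap by blast
  have hom: "eval_word' \<in> hom (free_product (H ` X) (\<lambda>A. G\<lparr>carrier := A\<rparr>)) G"
    unfolding eval_word'_def using fp_eval_hom[of "H ` X" "\<lambda>A. A"] sub by blast
  have grF: "group (free_product (H ` X) (\<lambda>A. G\<lparr>carrier := A\<rparr>))"
    using sub by (intro group_free_product) (auto simp: subgroup.subgroup_is_group is_group)
  interpret h: group_hom "free_product (H ` X) (\<lambda>A. G\<lparr>carrier := A\<rparr>)" G eval_word'
    by (intro group_hom.intro group_hom_axioms.intro grF is_group hom)
  have img': "eval_word' ` ?R' = L" unfolding R' image_image eval_word_map by (rule img)
  have "w = []" if "w \<in> ?R'" "eval_word' w = \<one>" for w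
    using that unmap[of w] ker eval_word_map by force
  moreover have "eval_word' [] = \<one>" by (simp add: eval_word'_def)
  ultimately have "{w \<in> ?R'. eval_word' w = \<one>} = {[]}" by auto
  then have "inj_on eval_word' ?R'"
    using h.trivial_ker_imp_inj by (auto simp: kernel_def free_product_def)
  then have "eval_word' \<in> iso (free_product (H ` X) (\<lambda>A. G\<lparr>carrier := A\<rparr>)) (G\<lparr>carrier := L\<rparr>)"
    using hom img' by (auto simp: iso_def bij_betw_def free_product_def hom_def)
  moreover have "subgroup A (G\<lparr>carrier := L\<rparr>)" if "A \<in> H ` X" for A
    using that sub HL L by (auto intro: subgroup_incl)
  ultimately show ?thesis
    unfolding freely_generated_by_def eval_word'_def by simp
qed

section \<open>Labelled free products\<close>

text \<open>
  The letter \<open>j\<close> has label \<open>c j\<close> and is introduced at level \<open>rk j\<close>. A letter \<open>t \<in> T\<close> and its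
  partner \<open>p t\<close> serve to recover the letter \<open>b t\<close> from the word \<open>g t\<close>.
\<close>

locale labelled_free_product =
  fixes \<Lambda> :: "('a, 'b) monoid_scheme"
    and J :: "'j set"
    and c :: "'j \<Rightarrow> 'i::complete_lattice"
    and rk :: "'j \<Rightarrow> nat"
    and T :: "'j set"
    and p :: "'j \<Rightarrow> 'j"
    and g :: "'j \<Rightarrow> ('j \<times> 'a) list"
    and b :: "'j \<Rightarrow> 'j"
    and \<sigma> :: 'a
  assumes group_base: "group \<Lambda>"
    and sigma: "\<sigma> \<in> carrier \<Lambda>" "\<sigma> \<noteq> \<one>\<^bsub>\<Lambda>\<^esub>"
    and compact_c: "\<And>j. j \<in> J \<Longrightarrow> compact_element (c j)"
    and T_J: "\<And>t. t \<in> T \<Longrightarrow> t \<in> J" "\<And>t. t \<in> T \<Longrightarrow> p t \<in> J"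
    and p_notin_T: "\<And>t. t \<in> T \<Longrightarrow> p t \<notin> T"
    and rk_p: "\<And>t. t \<in> T \<Longrightarrow> rk (p t) = rk t"
    and c_T: "\<And>t. t \<in> T \<Longrightarrow> c t = bot" "\<And>t. t \<in> T \<Longrightarrow> c (p t) = bot"
begin

abbreviation grp :: "'j \<Rightarrow> ('a, 'b) monoid_scheme"
  where "grp \<equiv> \<lambda>_. \<Lambda>"

definition K :: "('j \<times> 'a) list monoid"
  where "K = free_product J grp"

abbreviation mul :: "('j \<times> 'a) list \<Rightarrow> ('j \<times> 'a) list \<Rightarrow> ('j \<times> 'a) list"  (infixl "\<cdot>" 70)
  where "u \<cdot> w \<equiv> u \<otimes>\<^bsub>K\<^esub> w"

abbreviation inverse_word :: "('j \<times> 'a) list \<Rightarrow> ('j \<times> 'a) list"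
  where "inverse_word w \<equiv> inv\<^bsub>K\<^esub> w"

sublocale base: group \<Lambda> by (rule group_base)

sublocale K: group K
  unfolding K_def by (rule group_free_product) (rule group_base)

lemma K_simps: "carrier K = reduced_words J grp" "\<one>\<^bsub>K\<^esub> = []" "u \<cdot> w = foldr (fp_cons grp) u w"
  by (simp_all add: K_def free_product_def)

lemma one_K [simp]: "\<one>\<^bsub>K\<^esub> = []"
  by (rule K_simps)

lemma Nil_carrier [simp]: "[] \<in> carrier K"
  using K.one_closed by simp

lemma mul_Nil [simp]: "w \<in> carrier K \<Longrightarrow> w \<cdot> [] = w" "[] \<cdot> w = w"
  using K.r_one by (simp_all add: K_simps)

lemma mul_append: "u @ w \<in> carrier K \<Longrightarrow> u \<cdot> w = u @ w"
  unfolding K_simps by (rule fp_mult_append)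

lemma letter_carrier: "[(j, x)] \<in> carrier K \<longleftrightarrow> j \<in> J \<and> x \<in> carrier \<Lambda> \<and> x \<noteq> \<one>\<^bsub>\<Lambda>\<^esub>"
  by (simp add: K_simps reduced_words_Cons)

lemma inv_letter:
  assumes "j \<in> J" "x \<in> carrier \<Lambda>" "x \<noteq> \<one>\<^bsub>\<Lambda>\<^esub>"
  shows "inverse_word [(j, x)] = [(j, inv\<^bsub>\<Lambda>\<^esub> x)]"
  using assms by (intro K.inv_equality) (auto simp: K_simps reduced_words_Cons fp_push_def base.inv_eq_1_iff)

section \<open>Words graded by the rank of their letters\<close>

definition W :: "nat \<Rightarrow> ('j \<times> 'a) list set"
  where "W N = reduced_words {j \<in> J. rk j < N} grp"

lemma W_iff: "w \<in> W N \<longleftrightarrow> w \<in> carrier K \<and> (\<forall>l\<in>set w. rk (fst l) < N)"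
  by (auto simp: W_def K_simps reduced_words_def)

lemma subgroup_W: "subgroup (W N) K"
  unfolding W_def K_def by (rule subgroup_reduced_words) (auto intro: group_base)

lemma W_carrier: "w \<in> W N \<Longrightarrow> w \<in> carrier K"
  by (simp add: W_iff)

lemma W_mul: "u \<in> W N \<Longrightarrow> w \<in> W N \<Longrightarrow> u \<cdot> w \<in> W N"
  by (rule subgroup.m_closed[OF subgroup_W])

lemma W_inv: "w \<in> W N \<Longrightarrow> inverse_word w \<in> W N"
  by (rule subgroup.m_inv_closed[OF subgroup_W])

lemma W_Nil [simp]: "[] \<in> W N"
  by (simp add: W_iff)

lemma mul_append_low:
  assumes "u \<in> W N" "v = [] \<or> rk (fst (hd v)) \<ge> N"
  shows "u \<cdot> (w @ v) = (u \<cdot> w) @ v"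
  using assms unfolding K_simps by (intro fp_mult_append_right) (auto simp: W_iff)

lemma split_unique:
  assumes "u @ v = u' @ v'" "u \<in> W N" "u' \<in> W N"
    "v = [] \<or> rk (fst (hd v)) \<ge> N" "v' = [] \<or> rk (fst (hd v')) \<ge> N"
  shows "u = u' \<and> v = v'"
  using assms
  by (intro append_eq_append_split[where P = "\<lambda>l. rk (fst l) < N"]) (auto simp: W_iff)

lemma append_carrier:
  "u @ w \<in> carrier K \<longleftrightarrow> u \<in> carrier K \<and> w \<in> carrier K \<and> (u = [] \<or> w = [] \<or> fst (last u) \<noteq> fst (hd w))"
  unfolding K_simps by (rule reduced_words_append)

lemma Cons_carrier:
  "(j, x) # w \<in> carrier K \<longleftrightarrow> j \<in> J \<and> x \<in> carrier \<Lambda> \<and> x \<noteq> \<one>\<^bsub>\<Lambda>\<^esub> \<and> w \<in> carrier K \<and> (w = [] \<or> fst (hd w) \<noteq> j)"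
  unfolding K_simps by (rule reduced_words_Cons)

lemma split_word:
  assumes "w \<in> W (Suc N)"
  obtains "w \<in> W N" | k i x w' where "w = k @ (i, x) # w'" "k \<in> W N" "rk i = N" "(i, x) # w' \<in> W (Suc N)"
proof -
  let ?P = "\<lambda>l. rk (fst l) < N"
  have eq: "w = takeWhile ?P w @ dropWhile ?P w" by simp
  then have car: "takeWhile ?P w \<in> carrier K" "dropWhile ?P w \<in> carrier K"
    using assms append_carrier[of "takeWhile ?P w" "dropWhile ?P w"] by (auto simp: W_iff)
  have low: "takeWhile ?P w \<in> W N"
    using car by (auto simp: W_iff dest: set_takeWhileD)
  have high: "dropWhile ?P w \<in> W (Suc N)"
    using car assms by (auto simp: W_iff dest: set_dropWhileD)
  show ?thesis
  proof (cases "dropWhile ?P w")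
    case Nil
    then have "takeWhile ?P w = w" using eq by (metis append_Nil2)
    then show ?thesis using low that(1) by metis
  next
    case (Cons l w')
    have "\<not> ?P l" using Cons by (simp add: dropWhile_eq_Cons_conv)
    then have "rk (fst l) = N" using high Cons by (auto simp: W_iff)
    then show ?thesis using that(2)[of "takeWhile ?P w" "fst l" "snd l" w'] low high eq Cons by simp
  qed
qed

section \<open>Conjugators and blocks\<close>

definition cnj :: "'j \<Rightarrow> ('j \<times> 'a) list"
  where "cnj t = inverse_word (g t) \<cdot> [(t, \<sigma>)] \<cdot> g t \<cdot> [(p t, \<sigma>)]"

text \<open>The rigid core of the conjugate by \<open>cnj t\<close>: that conjugate equals the block
  multiplied by \<open>inverse_word (g t)\<close> on the left and by \<open>g t\<close> on the
  right. These outer factors are left off because they may cancel against their neighbours, whereas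
  the block stays intact in the products of \<open>shape_cases\<close>.\<close>

definition block :: "'j \<Rightarrow> 'a \<Rightarrow> ('j \<times> 'a) list"
  where "block t x = (t, \<sigma>) # g t @ (p t, \<sigma>) # (b t, x) # (p t, inv\<^bsub>\<Lambda>\<^esub> \<sigma>) # inverse_word (g t) @ [(t, inv\<^bsub>\<Lambda>\<^esub> \<sigma>)]"

definition admissible :: "'j \<Rightarrow> bool"
  where "admissible t \<longleftrightarrow> t \<in> T \<and> g t \<in> W (rk t) \<and> b t \<in> J \<and> rk (b t) < rk t"

fun fam :: "'j + 'j \<Rightarrow> ('j \<times> 'a) list set"
  where
    "fam (Inl j) = fp_factor grp j"
  | "fam (Inr t) = conjugate_set K (cnj t) (fp_factor grp (b t))"

lemma fp_factor_iff: "s \<in> fp_factor grp j \<longleftrightarrow> s = [] \<or> (\<exists>x\<in>carrier \<Lambda>. x \<noteq> \<one>\<^bsub>\<Lambda>\<^esub> \<and> s = [(j, x)])"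
  by (auto simp: fp_factor_def fp_push_def image_iff)

lemma subgroup_factor: "j \<in> J \<Longrightarrow> subgroup (fp_factor grp j) K"
  unfolding K_def by (rule fp_factor_subgroup) (rule group_base)

lemma inv_sigma: "inv\<^bsub>\<Lambda>\<^esub> \<sigma> \<in> carrier \<Lambda>" "inv\<^bsub>\<Lambda>\<^esub> \<sigma> \<noteq> \<one>\<^bsub>\<Lambda>\<^esub>"
  using sigma by (simp_all add: base.inv_eq_1_iff)

lemma sigma_letters:
  assumes "t \<in> T"
  shows "[(t, \<sigma>)] \<in> carrier K" "[(p t, \<sigma>)] \<in> carrier K"
  using assms sigma T_J by (auto simp: letter_carrier)

lemma cnj_carrier: "t \<in> T \<Longrightarrow> g t \<in> carrier K \<Longrightarrow> cnj t \<in> carrier K"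
  using sigma_letters[of t] by (simp add: cnj_def)

lemma low_not_letter: "w \<in> W N \<Longrightarrow> rk j \<ge> N \<Longrightarrow> w = [] \<or> (fst (hd w) \<noteq> j \<and> fst (last w) \<noteq> j)"
  unfolding W_iff using hd_in_set[of w] last_in_set[of w] by fastforce

text \<open>Ranks keep neighbours apart: \<open>g t\<close>, its inverse and \<open>b t\<close> only
  involve ranks below that of \<open>t\<close> and \<open>p t\<close>. If \<open>g t\<close> is
  empty, \<open>t\<close> and \<open>p t\<close> become adjacent; they differ because
  \<open>p t\<close> lies outside \<open>T\<close>.\<close>

lemma block_carrier:
  assumes "admissible t" "x \<in> carrier \<Lambda>" "x \<noteq> \<one>\<^bsub>\<Lambda>\<^esub>"
  shows "block t x \<in> carrier K"
proof -
  have t: "t \<in> T" "g t \<in> W (rk t)" "b t \<in> J" "rk (b t) < rk t"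
    using assms by (auto simp: admissible_def)
  have ig: "inverse_word (g t) \<in> W (rk t)" using t by (simp add: W_inv)
  have "p t \<noteq> t" "b t \<noteq> p t" using p_notin_T rk_p t by force+
  then show ?thesis
    using t ig assms sigma inv_sigma T_J[of t] low_not_letter[of "g t" "rk t" t] low_not_letter[of "g t" "rk t" "p t"]
       low_not_letter[of "inverse_word (g t)" "rk t" t] low_not_letter[of "inverse_word (g t)" "rk t" "p t"] rk_p[of t]
       W_carrier[OF t(2)] W_carrier[OF ig]
    by (auto simp: block_def Cons_carrier append_carrier hd_append)
qed

lemma conj_block:
  assumes "admissible t" "x \<in> carrier \<Lambda>" "x \<noteq> \<one>\<^bsub>\<Lambda>\<^esub>"
  shows "cnj t \<cdot> [(b t, x)] \<cdot> inverse_word (cnj t) = inverse_word (g t) \<cdot> block t x \<cdot> g t"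
proof -
  have t: "t \<in> T" "g t \<in> W (rk t)" "b t \<in> J" "rk (b t) < rk t"
    using assms by (auto simp: admissible_def)
  have gK: "g t \<in> carrier K" using t W_carrier by blast
  have bK: "[(b t, x)] \<in> carrier K" using t assms by (simp add: letter_carrier)
  note sl = sigma_letters[OF t(1)]
  have app: "((j, y) # v) = [(j, y)] \<cdot> v" if "(j, y) # v \<in> carrier K" for j y v
    using mul_append[of "[(j, y)]" v] that by simp
  let ?i = "inv\<^bsub>\<Lambda>\<^esub> \<sigma>" and ?v = "inverse_word (g t)"
  have c0: "block t x \<in> carrier K" by (rule block_carrier[OF assms])
  then have c1: "g t @ (p t, \<sigma>) # (b t, x) # (p t, ?i) # ?v @ [(t, ?i)] \<in> carrier K"
    by (simp add: block_def Cons_carrier)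
  then have c2: "(p t, \<sigma>) # (b t, x) # (p t, ?i) # ?v @ [(t, ?i)] \<in> carrier K"
    by (simp add: append_carrier)
  then have c3: "(b t, x) # (p t, ?i) # ?v @ [(t, ?i)] \<in> carrier K"
    by (simp add: Cons_carrier)
  then have c4: "(p t, ?i) # ?v @ [(t, ?i)] \<in> carrier K"
    by (simp add: Cons_carrier)
  then have c5: "?v @ [(t, ?i)] \<in> carrier K"
    by (simp add: Cons_carrier)
  have "block t x = [(t, \<sigma>)] \<cdot> (g t \<cdot> ([(p t, \<sigma>)] \<cdot> ([(b t, x)] \<cdot> ([(p t, ?i)] \<cdot> (?v \<cdot> [(t, ?i)])))))"
    using app[OF c0[unfolded block_def]] mul_append[OF c1] app[OF c2] app[OF c3] app[OF c4] mul_append[OF c5]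
    by (simp add: block_def)
  moreover have "[(p t, ?i)] = inverse_word [(p t, \<sigma>)]" "[(t, ?i)] = inverse_word [(t, \<sigma>)]"
    using inv_letter T_J t sigma by auto
  ultimately show ?thesis
    using gK bK sl by (simp add: cnj_def K.inv_mult_group K.m_assoc)
qed

lemma fam_Inr_iff:
  assumes "admissible t"
  shows "s \<in> fam (Inr t) \<longleftrightarrow>
    s = [] \<or> (\<exists>x\<in>carrier \<Lambda>. x \<noteq> \<one>\<^bsub>\<Lambda>\<^esub> \<and> s = inverse_word (g t) \<cdot> block t x \<cdot> g t)"
proof -
  have "cnj t \<in> carrier K" using assms by (auto simp: admissible_def intro: cnj_carrier W_carrier)
  then have "s \<in> fam (Inr t) \<longleftrightarrow> s = [] \<or> (\<exists>x\<in>carrier \<Lambda>. x \<noteq> \<one>\<^bsub>\<Lambda>\<^esub> \<and> s = cnj t \<cdot> [(b t, x)] \<cdot> inverse_word (cnj t))"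
    by (auto simp: conjugate_set_image fp_factor_iff image_iff Bex_def)
  then show ?thesis using conj_block[OF assms] by auto
qed

lemma block_mul:
  assumes "admissible t" "x \<in> carrier \<Lambda>" "x \<noteq> \<one>\<^bsub>\<Lambda>\<^esub>" "w \<in> carrier K" "w = [] \<or> fst (hd w) \<noteq> t"
  shows "block t x @ w \<in> carrier K" "block t x \<cdot> w = block t x @ w"
proof -
  show "block t x @ w \<in> carrier K"
    using assms block_carrier[OF assms(1-3)] unfolding append_carrier by (auto simp: block_def)
  then show "block t x \<cdot> w = block t x @ w" by (rule mul_append)
qed

subsection \<open>The subgroups attached to lattice elements, level by level\<close>

text \<open>
  \<open>Q N a\<close> is the part of \<open>K\<^sub>a\<close> generated by letters of rank below \<open>N\<close>. The last condition on
  \<open>t\<close> says that the label of \<open>b t\<close> is at most the least \<open>d\<close> with \<open>g t \<in> Q N d\<close>, whose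
  existence is only known after the induction on \<open>N\<close>.
\<close>

primrec Q :: "nat \<Rightarrow> 'i \<Rightarrow> ('j \<times> 'a) list set"
  where
    "Q 0 = (\<lambda>a. {[]})"
  | "Q (Suc N) = (\<lambda>a. generate K (Q N a \<union> (\<Union>j\<in>{j \<in> J. rk j = N \<and> c j \<le> a}. fam (Inl j)) \<union>
       (\<Union>t\<in>{t. admissible t \<and> rk t = N \<and> (\<forall>d. g t \<in> Q N d \<longrightarrow> c (b t) \<le> d)}. fam (Inr t))))"

declare Q.simps(2) [simp del]

text \<open>The side condition under which \<open>t\<close> contributes its conjugate in the
  recursion for \<open>Q\<close>, with the level read off as \<open>rk t\<close>.\<close>

definition valid :: "'j \<Rightarrow> bool"
  where "valid t \<longleftrightarrow> admissible t \<and> (\<forall>d. g t \<in> Q (rk t) d \<longrightarrow> c (b t) \<le> d)"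

lemma validD:
  assumes "valid t"
  shows "admissible t" "t \<in> T" "g t \<in> W (rk t)" "b t \<in> J" "rk (b t) < rk t"
    "g t \<in> carrier K" "cnj t \<in> carrier K" "g t \<in> Q (rk t) d \<Longrightarrow> c (b t) \<le> d"
  using assms by (auto simp: valid_def admissible_def intro: cnj_carrier W_carrier)

lemma Q_Suc: "Q (Suc N) a = generate K (Q N a \<union> (\<Union>j\<in>{j \<in> J. rk j = N \<and> c j \<le> a}. fam (Inl j)) \<union>
    (\<Union>t\<in>{t. valid t \<and> rk t = N}. fam (Inr t)))"
proof -
  have "{t. admissible t \<and> rk t = N \<and> (\<forall>d. g t \<in> Q N d \<longrightarrow> c (b t) \<le> d)} = {t. valid t \<and> rk t = N}"
    by (auto simp: valid_def)
  then show ?thesis by (simp add: Q.simps(2) del: fam.simps)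
qed

lemma W_mono: "N \<le> M \<Longrightarrow> w \<in> W N \<Longrightarrow> w \<in> W M"
  by (auto simp: W_iff)

lemma factor_W: "j \<in> J \<Longrightarrow> rk j < N \<Longrightarrow> fp_factor grp j \<subseteq> W N"
  by (auto simp: fp_factor_iff W_iff letter_carrier)

lemma cnj_W: "admissible t \<Longrightarrow> rk t < N \<Longrightarrow> cnj t \<in> W N"
  using sigma_letters[of t] rk_p[of t] W_mono[of "rk t" N "g t"]
  unfolding cnj_def admissible_def
  by (intro W_mul W_inv) (auto simp: W_iff[of "[(t, \<sigma>)]"] W_iff[of "[(p t, \<sigma>)]"])

lemma fam_Inr_W:
  assumes "admissible t" "rk t < N"
  shows "fam (Inr t) \<subseteq> W N"
proof
  fix s assume "s \<in> fam (Inr t)"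
  then obtain h where h: "h \<in> fp_factor grp (b t)" "s = cnj t \<cdot> h \<cdot> inverse_word (cnj t)"
    by (auto simp: conjugate_set_image)
  have "h \<in> W N"
    using h(1) factor_W[of "b t" N] assms by (auto simp: admissible_def)
  then show "s \<in> W N"
    unfolding h(2) using cnj_W[OF assms] by (intro W_mul W_inv)
qed

lemma subgroup_fam_Inr: "admissible t \<Longrightarrow> subgroup (fam (Inr t)) K"
  by (auto simp: admissible_def intro!: K.subgroup_conjugate_set subgroup_factor intro: cnj_carrier[OF _ W_carrier])

lemma Q_W: "Q N a \<subseteq> W N"
proof (induction N)
  case (Suc N)
  have "W N \<subseteq> W (Suc N)" using W_mono[of N "Suc N"] by auto
  moreover have "fam (Inl j) \<subseteq> W (Suc N)" if "j \<in> {j \<in> J. rk j = N \<and> c j \<le> a}" for j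
    using factor_W[of j "Suc N"] that by simp
  moreover have "fam (Inr t) \<subseteq> W (Suc N)" if "t \<in> {t. valid t \<and> rk t = N}" for t
    using fam_Inr_W[of t "Suc N"] validD(1) that by simp
  ultimately show ?case unfolding Q_Suc
    using Suc by (intro K.generate_subgroup_incl subgroup_W Un_least UN_least) blast+
qed simp

lemma Q_carrier: "w \<in> Q N a \<Longrightarrow> w \<in> carrier K"
  using Q_W W_carrier by blast

lemma subgroup_Q: "subgroup (Q N a) K"
proof (cases N)
  case 0
  then show ?thesis using K.triv_subgroup by simp
next
  case (Suc M)
  have "Q M a \<union> (\<Union>j\<in>{j \<in> J. rk j = M \<and> c j \<le> a}. fam (Inl j)) \<union>
      (\<Union>t\<in>{t. valid t \<and> rk t = M}. fam (Inr t)) \<subseteq> carrier K"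
  proof (intro Un_least UN_least)
    show "Q M a \<subseteq> carrier K" using Q_carrier by blast
    show "fam (Inl j) \<subseteq> carrier K" if "j \<in> {j \<in> J. rk j = M \<and> c j \<le> a}" for j
      using subgroup.subset[OF subgroup_factor[of j]] that by simp
    show "fam (Inr t) \<subseteq> carrier K" if "t \<in> {t. valid t \<and> rk t = M}" for t
      using subgroup.subset[OF subgroup_fam_Inr[of t]] that by (simp add: validD(1))
  qed
  then show ?thesis unfolding Suc Q_Suc by (rule K.generate_is_subgroup)
qed

lemma Q_mono: "Q N a \<subseteq> Q (Suc N) a"
  unfolding Q_Suc by (auto intro: generate.incl)

lemma Q_letter:
  assumes "j \<in> J" "rk j < N" "c j \<le> a"
  shows "fp_factor grp j \<subseteq> Q N a"
  using assms(2)
proof (induction N)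
  case (Suc N)
  then show ?case
    using assms Q_mono[of N a]
    by (cases "rk j = N") (auto simp: Q_Suc intro: generate.incl)
qed simp

lemma Q_Inr: "valid t \<Longrightarrow> rk t = N \<Longrightarrow> fam (Inr t) \<subseteq> Q (Suc N) a"
  unfolding Q_Suc by (auto intro: generate.incl)

text \<open>
  For \<open>g t \<in> Q (rk t) a\<close> the conjugate attached to \<open>t\<close> is redundant, since then \<open>cnj t\<close> and
  the copy \<open>b t\<close> already lie in the subgroup.
\<close>

definition basis :: "nat \<Rightarrow> 'i \<Rightarrow> ('j + 'j) set"
  where "basis N a =
    Inl ` {j \<in> J. rk j < N \<and> c j \<le> a} \<union> Inr ` {t. valid t \<and> rk t < N \<and> g t \<notin> Q (rk t) a}"

lemma basis_iff [simp]:
  "Inl j \<in> basis N a \<longleftrightarrow> j \<in> J \<and> rk j < N \<and> c j \<le> a"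
  "Inr t \<in> basis N a \<longleftrightarrow> valid t \<and> rk t < N \<and> g t \<notin> Q (rk t) a"
  by (auto simp: basis_def)

abbreviation fam_words :: "('j + 'j) set \<Rightarrow> (('j + 'j) \<times> ('j \<times> 'a) list) list set"
  where "fam_words X \<equiv> reduced_words X (\<lambda>f. K\<lparr>carrier := fam f\<rparr>)"

definition eval_word :: "(('j + 'j) \<times> ('j \<times> 'a) list) list \<Rightarrow> ('j \<times> 'a) list"
  where "eval_word V = foldr (\<lambda>(f, s) y. s \<cdot> y) V \<one>\<^bsub>K\<^esub>"

lemma eval_word_simps [simp]: "eval_word [] = []" "eval_word ((f, s) # V) = s \<cdot> eval_word V"
  by (simp_all add: eval_word_def)

lemma fam_words_Cons:
  "(f, s) # V \<in> fam_words X \<longleftrightarrow>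
     f \<in> X \<and> s \<in> fam f \<and> s \<noteq> [] \<and> V \<in> fam_words X \<and> (V = [] \<or> fst (hd V) \<noteq> f)"
  by (auto simp: reduced_words_Cons)

lemma subgroup_basis: "f \<in> basis N a \<Longrightarrow> subgroup (fam f) K"
  by (cases f) (auto simp: subgroup_factor subgroup_fam_Inr validD simp del: fam.simps(2))

lemma eval_word_hom:
  assumes "\<And>f. f \<in> X \<Longrightarrow> subgroup (fam f) K"
  shows "eval_word \<in> hom (free_product X (\<lambda>f. K\<lparr>carrier := fam f\<rparr>)) K"
  using K.fp_eval_hom[of X fam] assms unfolding eval_word_def[abs_def] by blast

lemma subgroup_eval_word:
  assumes "\<And>f. f \<in> X \<Longrightarrow> subgroup (fam f) K"
  shows "subgroup (eval_word ` fam_words X) K"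
proof -
  have F: "group (free_product X (\<lambda>f. K\<lparr>carrier := fam f\<rparr>))"
    using assms by (intro group_free_product) (simp add: subgroup.subgroup_is_group K.is_group)
  interpret h: group_hom "free_product X (\<lambda>f. K\<lparr>carrier := fam f\<rparr>)" K eval_word
    by (intro group_hom.intro group_hom_axioms.intro F K.is_group eval_word_hom assms)
  show ?thesis using h.img_is_subgroup by (simp add: free_product_def)
qed

lemma eval_word_carrier: "V \<in> fam_words (basis N a) \<Longrightarrow> eval_word V \<in> carrier K"
  by (rule subgroup.mem_carrier[OF subgroup_eval_word[of "basis N a"]]) (auto intro: subgroup_basis)

lemma eval_word_single:
  assumes "subgroup (fam f) K" "f \<in> X"
  shows "fam f \<subseteq> eval_word ` fam_words X"
proof
  fix s assume "s \<in> fam f"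
  show "s \<in> eval_word ` fam_words X"
  proof (cases "s = []")
    case True
    then show ?thesis by (intro image_eqI[of _ _ "[]"]) auto
  next
    case False
    have "s \<in> carrier K" using assms(1) \<open>s \<in> fam f\<close> by (rule subgroup.mem_carrier)
    then show ?thesis
      using False assms(2) \<open>s \<in> fam f\<close>
      by (intro image_eqI[of _ _ "[(f, s)]"]) (auto simp: fam_words_Cons simp del: fam.simps)
  qed
qed

lemma basis_mono: "basis N a \<subseteq> basis (Suc N) a"
  by (auto simp: basis_def)

lemma fam_words_mono: "X \<subseteq> Y \<Longrightarrow> fam_words X \<subseteq> fam_words Y"
  by (rule reduced_words_mono)

text \<open>The invariant of the induction on levels. Freeness at level \<open>N\<close> makes the
  normal forms one level up readable, and the least labels there are joins of least labels at level
  \<open>N\<close> and labels of letters.\<close>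

definition level_ok :: "nat \<Rightarrow> bool"
  where "level_ok N \<longleftrightarrow>
    (\<forall>a. Q N a = eval_word ` fam_words (basis N a)) \<and>
    (\<forall>a. \<forall>V\<in>fam_words (basis N a). eval_word V = [] \<longrightarrow> V = []) \<and>
    (\<forall>w\<in>W N. \<exists>d. compact_element d \<and> (\<forall>a. w \<in> Q N a \<longleftrightarrow> d \<le> a))"

section \<open>The step from level \<open>N\<close> to level \<open>N + 1\<close>\<close>

context
  fixes N assumes ok: "level_ok N"
begin

lemma eval_word_Q: "V \<in> fam_words (basis N a) \<Longrightarrow> eval_word V \<in> Q N a"
  using ok by (auto simp: level_ok_def)

lemma eval_word_eq_Nil: "V \<in> fam_words (basis N a) \<Longrightarrow> eval_word V = [] \<Longrightarrow> V = []"
  using ok by (auto simp: level_ok_def)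

text \<open>As \<open>g t\<close> lies outside \<open>Q N a\<close>, no element of
  \<open>Q N a\<close> cancels it. The low word left beside a block is therefore nonempty and
  separates the block from a neighbouring letter of rank \<open>N\<close>.\<close>

lemma mul_g_nonempty:
  assumes "valid t" "rk t = N" "g t \<notin> Q N a" "q \<in> Q N a"
  shows "g t \<cdot> q \<noteq> []" "q \<cdot> inverse_word (g t) \<noteq> []"
proof -
  have q: "q \<in> carrier K" "inverse_word q \<in> Q N a"
    using assms(4) Q_carrier subgroup.m_inv_closed[OF subgroup_Q] by auto
  show "g t \<cdot> q \<noteq> []"
    using K.inv_equality[of "g t" q] q assms(3) validD(6)[OF assms(1)] by auto
  show "q \<cdot> inverse_word (g t) \<noteq> []"
    using K.inv_equality[of q "inverse_word (g t)"] q assms(3,4) validD(6)[OF assms(1)] by auto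
qed

lemma Q_inv: "q \<in> Q M a \<Longrightarrow> inverse_word q \<in> Q M a"
  by (rule subgroup.m_inv_closed[OF subgroup_Q])

lemma Q_mul: "q \<in> Q M a \<Longrightarrow> r \<in> Q M a \<Longrightarrow> q \<cdot> r \<in> Q M a"
  by (rule subgroup.m_closed[OF subgroup_Q])

text \<open>The normal form of a product of basis factors, cut at its first factor of rank
  \<open>N\<close>. Factors are multiplied in from the left; one of rank \<open>N\<close> brings a
  letter or a block, and the point is that it does not merge with the word behind it.\<close>

lemma shape_cases:
  assumes "V \<in> fam_words (basis (Suc N) a)"
  obtains "V \<in> fam_words (basis N a)"
  | V0 i x V' where "V = V0 @ (Inl i, [(i, x)]) # V'" "V0 \<in> fam_words (basis N a)"
      "V' \<in> fam_words (basis (Suc N) a)" "i \<in> J" "rk i = N" "c i \<le> a"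
      "x \<in> carrier \<Lambda>" "x \<noteq> \<one>\<^bsub>\<Lambda>\<^esub>" "eval_word V = eval_word V0 @ (i, x) # eval_word V'" "eval_word V \<in> carrier K"
  | V0 t s x V' where "V = V0 @ (Inr t, s) # V'" "V0 \<in> fam_words (basis N a)"
      "V' \<in> fam_words (basis (Suc N) a)" "valid t" "rk t = N" "g t \<notin> Q N a"
      "x \<in> carrier \<Lambda>" "x \<noteq> \<one>\<^bsub>\<Lambda>\<^esub>"
      "eval_word V = (eval_word V0 \<cdot> inverse_word (g t)) @ block t x @ (g t \<cdot> eval_word V')" "eval_word V \<in> carrier K"
proof -
  have "V \<in> fam_words (basis N a) \<or>
    (\<exists>V0 i x V'. V = V0 @ (Inl i, [(i, x)]) # V' \<and> V0 \<in> fam_words (basis N a) \<and>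
      V' \<in> fam_words (basis (Suc N) a) \<and> i \<in> J \<and> rk i = N \<and> c i \<le> a \<and>
      x \<in> carrier \<Lambda> \<and> x \<noteq> \<one>\<^bsub>\<Lambda>\<^esub> \<and> eval_word V = eval_word V0 @ (i, x) # eval_word V') \<or>
    (\<exists>V0 t s x V'. V = V0 @ (Inr t, s) # V' \<and> V0 \<in> fam_words (basis N a) \<and>
      V' \<in> fam_words (basis (Suc N) a) \<and> valid t \<and> rk t = N \<and> g t \<notin> Q N a \<and>
      x \<in> carrier \<Lambda> \<and> x \<noteq> \<one>\<^bsub>\<Lambda>\<^esub> \<and>
      eval_word V = (eval_word V0 \<cdot> inverse_word (g t)) @ block t x @ (g t \<cdot> eval_word V'))"
    (is "?A V \<or> ?B V \<or> ?C V")
    using assms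
  proof (induction V)
    case Nil
    then show ?case by simp
  next
    case (Cons l V)
    obtain f s where l: "l = (f, s)" by (cases l)
    have f: "f \<in> basis (Suc N) a" "s \<in> fam f" "s \<noteq> []" "V \<in> fam_words (basis (Suc N) a)"
      "V = [] \<or> fst (hd V) \<noteq> f"
      using Cons.prems l by (auto simp: fam_words_Cons simp del: fam.simps)
    have IH: "?A V \<or> ?B V \<or> ?C V" using Cons.IH f by blast
    have sK: "s \<in> carrier K" using subgroup.mem_carrier[OF subgroup_basis[OF f(1)] f(2)] .
    have VK: "eval_word V \<in> carrier K" using eval_word_carrier f(4) by blast
    show ?case
    proof (cases "f \<in> basis N a")
      case True
      \<comment> \<open>A low factor multiplies into the low prefix only, so any letter or block
        found in \<open>V\<close> stays where it is.\<close>
      have sW: "s \<in> W N"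
        using f True factor_W[of _ N] fam_Inr_W[of _ N] by (cases f) (auto dest: validD simp del: fam.simps(2))
      have hd_V0: "(f, s) # V0 \<in> fam_words (basis N a)"
        if "V0 \<in> fam_words (basis N a)" "V = V0 @ V1" for V0 V1
        using that f True by (cases V0) (auto simp: fam_words_Cons)
      from IH consider "?A V" | "?B V" | "?C V" by blast
      then show ?thesis
      proof cases
        case 1
        then show ?thesis using f True l by (auto simp: fam_words_Cons simp del: fam.simps)
      next
        case 2
        then obtain V0 i x V' where h: "V = V0 @ (Inl i, [(i, x)]) # V'" "V0 \<in> fam_words (basis N a)"
          "V' \<in> fam_words (basis (Suc N) a)" "i \<in> J" "rk i = N" "c i \<le> a"
          "x \<in> carrier \<Lambda>" "x \<noteq> \<one>\<^bsub>\<Lambda>\<^esub>" "eval_word V = eval_word V0 @ (i, x) # eval_word V'" by blast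
        have "eval_word (l # V) = (s \<cdot> eval_word V0) @ (i, x) # eval_word V'"
          using l h(5) by (simp add: h(9) mul_append_low[OF sW])
        then have "?B (l # V)"
          using h hd_V0[OF h(2,1)] l by (intro exI[of _ "l # V0"] exI[of _ i] exI[of _ x] exI[of _ V']) simp
        then show ?thesis by blast
      next
        case 3
        then obtain V0 t s' x V' where h: "V = V0 @ (Inr t, s') # V'" "V0 \<in> fam_words (basis N a)"
          "V' \<in> fam_words (basis (Suc N) a)" "valid t" "rk t = N" "g t \<notin> Q N a"
          "x \<in> carrier \<Lambda>" "x \<noteq> \<one>\<^bsub>\<Lambda>\<^esub>"
          "eval_word V = (eval_word V0 \<cdot> inverse_word (g t)) @ block t x @ (g t \<cdot> eval_word V')" by blast
        have "eval_word V0 \<in> carrier K" using eval_word_Q h Q_carrier by blast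
        then have "eval_word (l # V) = (s \<cdot> eval_word V0 \<cdot> inverse_word (g t)) @ block t x @ (g t \<cdot> eval_word V')"
          using l h(5) validD[OF h(4)] sK
          by (simp add: h(9) mul_append_low[OF sW] block_def K.m_assoc)
        then have "?C (l # V)"
          using h hd_V0[OF h(2,1)] l
          by (intro exI[of _ "l # V0"] exI[of _ t] exI[of _ s'] exI[of _ x] exI[of _ V']) simp
        then show ?thesis by blast
      qed
    next
      case False
      show ?thesis
      proof (cases f)
        case (Inl i)
        then have i: "i \<in> J" "rk i = N" "c i \<le> a" using f False by auto
        obtain x where x: "x \<in> carrier \<Lambda>" "x \<noteq> \<one>\<^bsub>\<Lambda>\<^esub>" "s = [(i, x)]"
          using f Inl by (auto simp: fp_factor_iff)
        \<comment> \<open>The letter \<open>i\<close> must not merge with what follows. A block is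
          shielded by a nonempty low word. A letter with nothing low in front of it means
          \<open>V0 = []\<close> by freeness at level \<open>N\<close>, and then \<open>V\<close>
          starts with a factor other than \<open>Inl i\<close>.\<close>
        have "eval_word V = [] \<or> fst (hd (eval_word V)) \<noteq> i"
        proof -
          from IH consider "?A V" | "?B V" | "?C V" by blast
          then show ?thesis
          proof cases
            case 1
            then show ?thesis using eval_word_Q[of V a] Q_W[of N a] low_not_letter[of "eval_word V" N i] i by blast
          next
            case 2
            then obtain V0 i' x' V' where h: "V = V0 @ (Inl i', [(i', x')]) # V'" "V0 \<in> fam_words (basis N a)"
              "eval_word V = eval_word V0 @ (i', x') # eval_word V'" by blast
            show ?thesis
            proof (cases "eval_word V0 = []")
              case True
              then have "V0 = []" using eval_word_eq_Nil h by blast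
              then show ?thesis using h f(5) Inl by auto
            next
              case False
              have "eval_word V0 \<in> W N" using eval_word_Q h Q_W by blast
              then show ?thesis using low_not_letter[of "eval_word V0" N i] False i h by simp
            qed
          next
            case 3
            then obtain V0 t s' x' V' where h: "V0 \<in> fam_words (basis N a)"
              "valid t" "rk t = N" "g t \<notin> Q N a"
              "eval_word V = (eval_word V0 \<cdot> inverse_word (g t)) @ block t x' @ (g t \<cdot> eval_word V')" by blast
            have q: "eval_word V0 \<in> Q N a" using eval_word_Q h by blast
            then have "eval_word V0 \<cdot> inverse_word (g t) \<in> W N"
              using Q_W validD(3)[OF h(2)] h(3) by (auto intro!: W_mul W_inv)
            then show ?thesis
              using low_not_letter[of "eval_word V0 \<cdot> inverse_word (g t)" N i] mul_g_nonempty(2)[OF h(2-4) q] i h(5) by simp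
          qed
        qed
        then have "(i, x) # eval_word V \<in> carrier K" using x i VK by (simp add: Cons_carrier)
        then have "eval_word (l # V) = eval_word [] @ (i, x) # eval_word V"
          using mul_append[of "[(i, x)]" "eval_word V"] x l by simp
        then have "?B (l # V)"
          using l Inl x i f(4) by (intro exI[of _ "[]"] exI[of _ i] exI[of _ x] exI[of _ V]) simp
        then show ?thesis by blast
      next
        case (Inr t)
        then have t: "valid t" "rk t = N" "g t \<notin> Q N a"
          using f(1) False by (auto simp: less_Suc_eq)
        note vt = validD[OF t(1)]
        obtain x where x: "x \<in> carrier \<Lambda>" "x \<noteq> \<one>\<^bsub>\<Lambda>\<^esub>" "s = inverse_word (g t) \<cdot> block t x \<cdot> g t"
          using f Inr fam_Inr_iff[OF vt(1)] by (auto simp del: fam.simps)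
        have gW: "g t \<in> W N" using vt t by simp
        let ?y = "g t \<cdot> eval_word V"
        have yK: "?y \<in> carrier K" using vt VK by simp
        \<comment> \<open>The block ends in the letter \<open>t\<close>, so \<open>?y\<close> must
          not begin with it. A following letter of rank \<open>N\<close>, which may be
          \<open>t\<close> itself, is shielded by the nonempty word
          \<open>g t \<cdot> eval_word V0\<close>.\<close>
        have "?y = [] \<or> fst (hd ?y) \<noteq> t"
        proof -
          from IH consider "?A V" | "?B V" | "?C V" by blast
          then show ?thesis
          proof cases
            case 1
            then have "?y \<in> W N" using eval_word_Q Q_W gW by (blast intro: W_mul)
            then show ?thesis using low_not_letter[of ?y N t] t by blast
          next
            case 2
            then obtain V0 i' x' V' where h: "V0 \<in> fam_words (basis N a)"
              "eval_word V = eval_word V0 @ (i', x') # eval_word V'" "rk i' = N" by blast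
            have q: "eval_word V0 \<in> Q N a" using eval_word_Q h by blast
            then have "g t \<cdot> eval_word V0 \<in> W N" using Q_W gW by (blast intro: W_mul)
            moreover have "?y = (g t \<cdot> eval_word V0) @ (i', x') # eval_word V'"
              using h by (simp add: mul_append_low[OF gW])
            ultimately show ?thesis
              using low_not_letter[of "g t \<cdot> eval_word V0" N t] mul_g_nonempty(1)[OF t q] t by simp
          next
            case 3
            then obtain V0 t' s' x' V' where h: "V0 \<in> fam_words (basis N a)" "V = V0 @ (Inr t', s') # V'"
              "valid t'" "rk t' = N" "g t' \<notin> Q N a"
              "eval_word V = (eval_word V0 \<cdot> inverse_word (g t')) @ block t' x' @ (g t' \<cdot> eval_word V')" by blast
            let ?k = "g t \<cdot> (eval_word V0 \<cdot> inverse_word (g t'))"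
            have q: "eval_word V0 \<in> Q N a" using eval_word_Q h by blast
            then have qK: "eval_word V0 \<in> carrier K" using Q_carrier by blast
            have kW: "?k \<in> W N"
              using Q_W q validD(3)[OF h(3)] h(4) gW by (auto intro!: W_mul W_inv)
            have y: "?y = ?k @ block t' x' @ (g t' \<cdot> eval_word V')"
              using h by (simp add: mul_append_low[OF gW] block_def)
            show ?thesis
            proof (cases "?k = []")
              case True
              \<comment> \<open>Here two blocks touch with nothing between them. They meet in
                different letters: \<open>t' = t\<close> would make the value of \<open>V0\<close>
                trivial, hence \<open>V0 = []\<close> by freeness, and two neighbouring factors of a
                reduced word would have the same index.\<close>
              have "t' \<noteq> t"
              proof
                assume [simp]: "t' = t"
                have "g t \<cdot> eval_word V0 = g t"
                  using True qK vt(6) K.inv_equality[of "g t \<cdot> eval_word V0" "inverse_word (g t)"]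
                  by (simp add: K.m_assoc)
                then have "eval_word V0 = []" using qK vt(6) K.r_cancel_one'[of "eval_word V0" "g t"] K.l_cancel_one[of "g t" "eval_word V0"] by simp
                then have "V0 = []" using eval_word_eq_Nil h by blast
                then show False using f(5) h(2) Inr by simp
              qed
              then show ?thesis using y True by (simp add: block_def)
            next
              case False
              then show ?thesis using low_not_letter[OF kW, of t] t y by simp
            qed
          qed
        qed
        then have "block t x \<cdot> ?y = block t x @ ?y" "block t x @ ?y \<in> carrier K"
          using block_mul[OF vt(1) x(1,2) yK] by auto
        moreover have "s \<cdot> eval_word V = inverse_word (g t) \<cdot> (block t x \<cdot> ?y)"
          using x vt VK block_carrier[OF vt(1) x(1,2)] by (simp add: K.m_assoc)
        moreover have "inverse_word (g t) \<cdot> ([] @ (block t x @ ?y)) = (inverse_word (g t) \<cdot> []) @ block t x @ ?y"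
          using gW t by (intro mul_append_low[of _ N] W_inv) (auto simp: block_def)
        ultimately have "eval_word (l # V) = (eval_word [] \<cdot> inverse_word (g t)) @ block t x @ ?y"
          using l vt by simp
        then have "?C (l # V)"
          using l Inr x t f(4) by (intro exI[of _ "[]"] exI[of _ t] exI[of _ s] exI[of _ x] exI[of _ V]) simp
        then show ?thesis by blast
      qed
    qed
  qed
  then show thesis using that eval_word_carrier[OF assms] by blast
qed

text \<open>In the shapes with a letter of rank \<open>N\<close> or a block the value is visibly
  nonempty; otherwise freeness at level \<open>N\<close> applies.\<close>

lemma free_Suc:
  assumes "V \<in> fam_words (basis (Suc N) a)" "eval_word V = []"
  shows "V = []"
  using assms(1)
  by (cases rule: shape_cases) (use assms(2) eval_word_eq_Nil in \<open>auto simp: block_def\<close>)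

lemma Q_Suc_eval_word: "Q (Suc N) a = eval_word ` fam_words (basis (Suc N) a)"
proof
  let ?I = "eval_word ` fam_words (basis (Suc N) a)"
  have sub: "subgroup ?I K" by (rule subgroup_eval_word[OF subgroup_basis])
  have letter: "fp_factor grp j \<subseteq> ?I" if "j \<in> J" "rk j < Suc N" "c j \<le> a" for j
    using eval_word_single[of "Inl j" "basis (Suc N) a"] that by (simp add: subgroup_factor)
  have QI: "Q N a \<subseteq> ?I"
    using ok fam_words_mono[OF basis_mono[of N a]] by (auto simp: level_ok_def)
  have "fam (Inr t) \<subseteq> ?I" if t: "valid t" "rk t = N" for t
  proof (cases "g t \<in> Q N a")
    case False
    then show ?thesis
      using eval_word_single[of "Inr t" "basis (Suc N) a"] subgroup_fam_Inr[OF validD(1)[OF t(1)]] t by simp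
  next
    case True
    note vt = validD[OF t(1)]
    have "g t \<in> ?I" using True QI by blast
    moreover have "[(t, \<sigma>)] \<in> ?I" "[(p t, \<sigma>)] \<in> ?I"
      using letter[of t] letter[of "p t"] T_J[of t] c_T[of t] rk_p[of t] vt t sigma
      by (auto simp: fp_factor_iff)
    ultimately have "cnj t \<in> ?I"
      unfolding cnj_def by (intro subgroup.m_closed[OF sub] subgroup.m_inv_closed[OF sub])
    \<comment> \<open>Validity is used here: with \<open>g t\<close> in \<open>Q N a\<close> it
      gives \<open>c (b t) \<le> a\<close>, so \<open>Inl (b t)\<close> belongs to the
      basis.\<close>
    moreover have "fp_factor grp (b t) \<subseteq> ?I"
      using letter[of "b t"] vt t True by simp
    ultimately show ?thesis
      by (auto simp: conjugate_set_image intro!: subgroup.m_closed[OF sub] subgroup.m_inv_closed[OF sub])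
  qed
  then show "Q (Suc N) a \<subseteq> ?I"
    unfolding Q_Suc using letter QI
    by (intro K.generate_subgroup_incl sub Un_least UN_least) (auto simp del: fam.simps(2))
  have "eval_word V \<in> Q (Suc N) a" if "V \<in> fam_words (basis (Suc N) a)" for V
    using that
  proof (induction V)
    case Nil
    then show ?case using subgroup.one_closed[OF subgroup_Q] by simp
  next
    case (Cons l V)
    obtain f s where l: "l = (f, s)" by (cases l)
    have f: "f \<in> basis (Suc N) a" "s \<in> fam f" "V \<in> fam_words (basis (Suc N) a)"
      using Cons.prems l by (auto simp: fam_words_Cons simp del: fam.simps)
    have "s \<in> Q (Suc N) a"
    proof (cases f)
      case (Inl j)
      then show ?thesis using f Q_letter[of j "Suc N" a] by auto
    next
      case (Inr t)
      show ?thesis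
      proof (cases "rk t = N")
        case True
        then show ?thesis using Q_Inr[of t N a] f Inr by auto
      next
        case False
        then have "Inr t \<in> basis N a" using f Inr by auto
        then have "s \<in> eval_word ` fam_words (basis N a)"
          using eval_word_single[OF subgroup_basis, of "Inr t" N a] f(2) unfolding Inr by blast
        then show ?thesis using eval_word_Q Q_mono[of N a] by blast
      qed
    qed
    then show ?case using Cons.IH f l Q_mul by simp
  qed
  then show "?I \<subseteq> Q (Suc N) a" by blast
qed

section \<open>Membership one level up and least labels\<close>

lemma Q_Suc_low:
  assumes "w \<in> W N"
  shows "w \<in> Q (Suc N) a \<longleftrightarrow> w \<in> Q N a"
proof
  assume "w \<in> Q (Suc N) a"
  then obtain V where V: "V \<in> fam_words (basis (Suc N) a)" "w = eval_word V"
    unfolding Q_Suc_eval_word by blast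
  from V(1) show "w \<in> Q N a"
  proof (cases rule: shape_cases)
    case 1
    then show ?thesis using V eval_word_Q by simp
  \<comment> \<open>The values in the other two shapes contain a letter of rank \<open>N\<close>,
    which \<open>w\<close> does not.\<close>
  qed (use assms V in \<open>auto simp: W_iff block_def\<close>)
qed (use Q_mono in blast)

text \<open>The place of the first letter of rank \<open>N\<close> in a word is unique, so its
  prefix and tail can be compared with those of the normal form. Before a block the prefix is an
  element of \<open>Q N a\<close> times \<open>inverse_word (g t)\<close>, whence the condition on
  \<open>k \<cdot> g t\<close>.\<close>

lemma Q_Suc_high:
  assumes "k @ (i, y) # w \<in> Q (Suc N) a" "k \<in> W N" "rk i = N"
  obtains "k \<in> Q N a" "c i \<le> a" "w \<in> Q (Suc N) a"
  | t x z where "valid t" "rk t = N" "x \<in> carrier \<Lambda>" "x \<noteq> \<one>\<^bsub>\<Lambda>\<^esub>" "k \<cdot> g t \<in> Q N a"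
      "z \<in> Q (Suc N) a" "(i, y) # w = block t x @ (g t \<cdot> z)"
proof -
  obtain V where V: "V \<in> fam_words (basis (Suc N) a)" "k @ (i, y) # w = eval_word V"
    using assms(1) unfolding Q_Suc_eval_word by blast
  from V(1) show thesis
  proof (cases rule: shape_cases)
    case 1
    then have "eval_word V \<in> W N" using eval_word_Q Q_W by blast
    then show ?thesis using V(2)[symmetric] assms(3) by (auto simp: W_iff)
  next
    case (2 V0 i' x V')
    have "eval_word V0 \<in> W N" "eval_word V0 \<in> Q N a" using 2 eval_word_Q Q_W by blast+
    moreover from this have "k = eval_word V0 \<and> (i, y) # w = (i', x) # eval_word V'"
      using 2 assms V by (intro split_unique[where N = N]) auto
    moreover have "eval_word V' \<in> Q (Suc N) a" using 2 Q_Suc_eval_word by blast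
    ultimately show ?thesis using that(1) 2 by simp
  next
    case (3 V0 t s x V')
    note vt = validD[OF 3(4)]
    have q: "eval_word V0 \<in> W N" "eval_word V0 \<in> Q N a" using 3 eval_word_Q Q_W by blast+
    then have "eval_word V0 \<cdot> inverse_word (g t) \<in> W N" using vt 3 by (auto intro!: W_mul W_inv)
    then have *: "k = eval_word V0 \<cdot> inverse_word (g t) \<and> (i, y) # w = block t x @ (g t \<cdot> eval_word V')"
      using 3 assms V by (intro split_unique[where N = N]) (auto simp: block_def)
    moreover have "eval_word V' \<in> Q (Suc N) a" using 3 Q_Suc_eval_word by blast
    moreover have "k \<cdot> g t = eval_word V0" using * q vt by (simp add: K.m_assoc Q_carrier)
    ultimately show ?thesis using that(2)[of t x "eval_word V'"] q 3 by simp
  qed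
qed

lemma valid_block_Q:
  assumes "valid t" "rk t = N" "x \<in> carrier \<Lambda>" "x \<noteq> \<one>\<^bsub>\<Lambda>\<^esub>"
  shows "inverse_word (g t) \<cdot> block t x \<cdot> g t \<in> Q (Suc N) a"
  using Q_Inr[OF assms(1,2), of a] fam_Inr_iff[OF validD(1)[OF assms(1)]] assms(3,4) by blast

text \<open>
  A word containing a block cannot be read in any other way: reading \<open>(t, \<sigma>)\<close> as a letter of its
  own forces \<open>g t\<close> to lie in \<open>Q N a\<close>, because the letter \<open>p t\<close> after it does not start a block.
\<close>

lemma threshold_block:
  assumes w: "w = k @ block t x @ v" "w \<in> carrier K" and k: "k \<in> W N"
    and t: "valid t" "rk t = N" "x \<in> carrier \<Lambda>" "x \<noteq> \<one>\<^bsub>\<Lambda>\<^esub>"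
  shows "w \<in> Q (Suc N) a \<longleftrightarrow> k \<cdot> g t \<in> Q N a \<and> inverse_word (g t) \<cdot> v \<in> Q (Suc N) a"
proof -
  note vt = validD[OF t(1)]
  \<comment> \<open>\<open>?m\<close> belongs to the conjugate attached to \<open>t\<close>, which
    every \<open>Q (Suc N) a\<close> contains. So \<open>w\<close> is factored into
    \<open>k \<cdot> g t\<close>, \<open>?m\<close> and \<open>inverse_word (g t) \<cdot> v\<close>,
    and only the outer two depend on \<open>a\<close> for membership.\<close>
  let ?m = "inverse_word (g t) \<cdot> block t x \<cdot> g t"
  have m: "?m \<in> Q (Suc N) a" by (rule valid_block_Q[OF t])
  have bK: "block t x \<in> carrier K" by (rule block_carrier[OF vt(1) t(3,4)])
  have c: "k \<in> carrier K" "v \<in> carrier K" "block t x @ v \<in> carrier K"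
    using w by (auto simp: append_carrier)
  have "w = k \<cdot> (block t x \<cdot> v)"
    using w c mul_append[of k "block t x @ v"] mul_append[of "block t x" v] by simp
  also have "\<dots> = (k \<cdot> g t) \<cdot> (?m \<cdot> (inverse_word (g t) \<cdot> v))"
    using c bK vt(6) by (simp add: K.m_assoc K.inv_solve_left)
       (simp add: K.m_assoc[symmetric])
  finally have weq: "w = (k \<cdot> g t) \<cdot> (?m \<cdot> (inverse_word (g t) \<cdot> v))" .
  have cl: "k \<cdot> g t \<in> carrier K" "?m \<in> carrier K" "inverse_word (g t) \<cdot> v \<in> carrier K"
    using c bK vt(6) by auto
  show ?thesis
  proof
    assume "k \<cdot> g t \<in> Q N a \<and> inverse_word (g t) \<cdot> v \<in> Q (Suc N) a"
    then show "w \<in> Q (Suc N) a"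
      unfolding weq using Q_mono[of N a] by (blast intro: Q_mul[OF _ Q_mul[OF m]])
  next
    assume wQ: "w \<in> Q (Suc N) a"
    have "k \<cdot> g t \<in> Q N a"
    proof -
      let ?r = "(b t, x) # (p t, inv\<^bsub>\<Lambda>\<^esub> \<sigma>) # inverse_word (g t) @ (t, inv\<^bsub>\<Lambda>\<^esub> \<sigma>) # v"
      have "k @ (t, \<sigma>) # g t @ (p t, \<sigma>) # ?r \<in> Q (Suc N) a"
        using wQ w by (simp add: block_def)
      then show ?thesis using k t(2)
      proof (cases rule: Q_Suc_high)
        case 1
        have gW: "g t \<in> W N" "rk (p t) = N" using vt t rk_p by auto
        from 1(3) gW have "g t \<in> Q N a"
        proof (cases rule: Q_Suc_high)
          case (2 t' x' z)
          then show ?thesis using p_notin_T[OF vt(2)] validD(2)[OF 2(1)] by (simp add: block_def)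
        qed
        then show ?thesis using 1 Q_mul by blast
      next
        \<comment> \<open>A block that starts with the letter \<open>t\<close> has
          \<open>t' = t\<close>, so this reading already gives the claim.\<close>
        case (2 t' x' z)
        then show ?thesis by (simp add: block_def)
      qed
    qed
    moreover have "inverse_word (g t) \<cdot> v = inverse_word ?m \<cdot> (inverse_word (k \<cdot> g t) \<cdot> w)"
      unfolding weq using cl by (simp add: K.m_assoc[symmetric])
    ultimately show "k \<cdot> g t \<in> Q N a \<and> inverse_word (g t) \<cdot> v \<in> Q (Suc N) a"
      using Q_mul[OF Q_inv[OF m] Q_mul[OF Q_inv[of "k \<cdot> g t" "Suc N" a] wQ]] Q_mono[of N a] by auto
  qed
qed

text \<open>With blocks excluded at the first letter of rank \<open>N\<close>, that letter has to be
  a factor of its own.\<close>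

lemma threshold_other:
  assumes w: "w = k @ (i, y) # v" "w \<in> carrier K" and k: "k \<in> W N" and i: "rk i = N"
    and other: "\<And>t x z. valid t \<Longrightarrow> rk t = N \<Longrightarrow> x \<in> carrier \<Lambda> \<Longrightarrow> x \<noteq> \<one>\<^bsub>\<Lambda>\<^esub> \<Longrightarrow> (i, y) # v \<noteq> block t x @ z"
  shows "w \<in> Q (Suc N) a \<longleftrightarrow> k \<in> Q N a \<and> c i \<le> a \<and> v \<in> Q (Suc N) a"
proof
  assume "w \<in> Q (Suc N) a"
  then have "k @ (i, y) # v \<in> Q (Suc N) a" using w by simp
  then show "k \<in> Q N a \<and> c i \<le> a \<and> v \<in> Q (Suc N) a"
    using k i by (cases rule: Q_Suc_high) (use other in blast)+
next
  assume h: "k \<in> Q N a \<and> c i \<le> a \<and> v \<in> Q (Suc N) a"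
  have c: "(i, y) # v \<in> carrier K" using w by (simp add: append_carrier)
  then have "[(i, y)] \<in> Q (Suc N) a"
    using Q_letter[of i "Suc N" a] h i by (auto simp: Cons_carrier fp_factor_iff)
  moreover have "w = k \<cdot> ([(i, y)] \<cdot> v)"
    using w c mul_append[of k "(i, y) # v"] mul_append[of "[(i, y)]" v] by simp
  ultimately show "w \<in> Q (Suc N) a"
    using h Q_mono[of N a] by (auto intro!: Q_mul)
qed

text \<open>Whether a block starts at the first letter of rank \<open>N\<close> is a property of the
  word and does not involve \<open>a\<close>. So one of the two criteria applies for all
  \<open>a\<close> at once, and the label is a join of the label of a low word, that of a remainder
  with fewer letters of rank \<open>N\<close> and, without a block, that of a letter.\<close>

lemma threshold_Suc:
  assumes "w \<in> W (Suc N)"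
  shows "\<exists>d. compact_element d \<and> (\<forall>a. w \<in> Q (Suc N) a \<longleftrightarrow> d \<le> a)"
  using assms
proof (induction "length (filter (\<lambda>l. rk (fst l) = N) w)" arbitrary: w rule: less_induct)
  case less
  let ?n = "\<lambda>w. length (filter (\<lambda>l. rk (fst l) = N) w)"
  have low: "\<exists>d. compact_element d \<and> (\<forall>a. k \<in> Q N a \<longleftrightarrow> d \<le> a)" if "k \<in> W N" for k
    using ok that by (auto simp: level_ok_def)
  have n_low: "?n k = 0" if "k \<in> W N" for k using that by (auto simp: W_iff filter_empty_conv)
  from less.prems show ?case
  proof (cases rule: split_word)
    case 1
    then show ?thesis using low Q_Suc_low by simp
  next
    case (2 k i y v)
    have vW: "v \<in> W (Suc N)" using 2(4) by (auto simp: W_iff Cons_carrier)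
    have wK: "w \<in> carrier K" using less.prems W_carrier by blast
    show ?thesis
    proof (cases "\<exists>t x z. valid t \<and> rk t = N \<and> x \<in> carrier \<Lambda> \<and> x \<noteq> \<one>\<^bsub>\<Lambda>\<^esub> \<and> (i, y) # v = block t x @ z")
      case True
      then obtain t x z where t: "valid t" "rk t = N" "x \<in> carrier \<Lambda>" "x \<noteq> \<one>\<^bsub>\<Lambda>\<^esub>"
        and eq: "(i, y) # v = block t x @ z" by blast
      note vt = validD[OF t(1)]
      have w: "w = k @ block t x @ z" using 2 eq by simp
      have gW: "g t \<in> W N" using vt t by simp
      have zW: "z \<in> W (Suc N)" using less.prems w by (auto simp: W_iff append_carrier)
      \<comment> \<open>The factor \<open>inverse_word (g t)\<close> cancels at most within the low
        prefix of \<open>z\<close>, so the letters of rank \<open>N\<close> are untouched.\<close>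
      have "?n (inverse_word (g t) \<cdot> z) = ?n z"
        using zW
      proof (cases rule: split_word)
        case 1
        then show ?thesis using n_low[OF W_mul[OF W_inv[OF gW]]] n_low by simp
      next
        case (2 k' i' y' v')
        then have "inverse_word (g t) \<cdot> z = (inverse_word (g t) \<cdot> k') @ (i', y') # v'"
          by (simp add: mul_append_low[OF W_inv[OF gW]])
        then show ?thesis using 2 n_low[OF W_mul[OF W_inv[OF gW]]] n_low by simp
      qed
      also have "\<dots> < ?n w" using w t by (simp add: block_def)
      finally have "\<exists>d. compact_element d \<and> (\<forall>a. inverse_word (g t) \<cdot> z \<in> Q (Suc N) a \<longleftrightarrow> d \<le> a)"
        using less.hyps[of "inverse_word (g t) \<cdot> z"] W_mul[OF W_inv[OF W_mono[OF _ gW]] zW] by simp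
      then obtain d2 where d2: "compact_element d2" "\<forall>a. inverse_word (g t) \<cdot> z \<in> Q (Suc N) a \<longleftrightarrow> d2 \<le> a"
        by blast
      obtain d1 where d1: "compact_element d1" "\<forall>a. k \<cdot> g t \<in> Q N a \<longleftrightarrow> d1 \<le> a"
        using low[OF W_mul[OF 2(2) gW]] by blast
      show ?thesis
        using threshold_block[OF w wK 2(2) t] d1 d2
        by (intro exI[of _ "sup d1 d2"]) (simp add: compact_element_sup)
    next
      case False
      have "?n v < ?n w" using 2 by simp
      then obtain d2 where d2: "compact_element d2" "\<forall>a. v \<in> Q (Suc N) a \<longleftrightarrow> d2 \<le> a"
        using less.hyps[of v] vW by blast
      obtain d1 where d1: "compact_element d1" "\<forall>a. k \<in> Q N a \<longleftrightarrow> d1 \<le> a"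
        using low[OF 2(2)] by blast
      have "i \<in> J" using 2(4) by (auto simp: W_iff Cons_carrier)
      then show ?thesis
        using threshold_other[OF 2(1) wK 2(2,3)] False d1 d2 compact_c[of i]
        by (intro exI[of _ "sup d1 (sup (c i) d2)"]) (simp add: compact_element_sup, blast)
    qed
  qed
qed

lemma level_ok_Suc: "level_ok (Suc N)"
  unfolding level_ok_def using Q_Suc_eval_word free_Suc threshold_Suc by blast

end

lemma W_0: "W 0 = {[]}"
proof -
  have "w = []" if "w \<in> W 0" for w using that by (cases w) (auto simp: W_iff)
  then show ?thesis by auto
qed

lemma level_ok_all: "level_ok N"
proof (induction N)
  case 0
  have "basis 0 a = {}" for a by (auto simp: basis_def)
  moreover have "V = []" if "V \<in> fam_words {}" for V
    using that by (cases V) (auto simp: reduced_words_def)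
  then have "fam_words {} = {[]}" by auto
  ultimately show ?case
    by (auto simp: level_ok_def W_0 intro!: exI[of _ bot] compact_element_bot)
qed (rule level_ok_Suc)

subsection \<open>Union over all levels\<close>

lemma Q_mono_le: "N \<le> M \<Longrightarrow> Q N a \<subseteq> Q M a"
  by (rule lift_Suc_mono_le[of "\<lambda>N. Q N a"]) (rule Q_mono)

lemma Q_low:
  assumes "w \<in> W N" "N \<le> M"
  shows "w \<in> Q M a \<longleftrightarrow> w \<in> Q N a"
  using assms(2)
proof (induction M rule: dec_induct)
  case (step M)
  then show ?case using Q_Suc_low[OF level_ok_all, of w M a] W_mono[of N M w] assms(1) by simp
qed simp

definition K_below :: "'i \<Rightarrow> ('j \<times> 'a) list set"
  where "K_below a = (\<Union>N. Q N a)"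

lemma Q_K_below: "w \<in> Q N a \<Longrightarrow> w \<in> K_below a"
  by (auto simp: K_below_def)

text \<open>Later levels add no words in old letters, so membership in the union is decided at any
  level whose letters suffice.\<close>

lemma K_below_W:
  assumes "w \<in> W N"
  shows "w \<in> K_below a \<longleftrightarrow> w \<in> Q N a"
proof
  assume "w \<in> K_below a"
  then obtain M where M: "w \<in> Q M a" by (auto simp: K_below_def)
  show "w \<in> Q N a"
  proof (cases "N \<le> M")
    case True
    then show ?thesis using Q_low[OF assms True] M by blast
  next
    case False
    then show ?thesis using Q_mono_le[of M N a] M by auto
  qed
qed (rule Q_K_below)

lemma subgroup_K_below: "subgroup (K_below a) K"
proof (rule K.subgroupI)
  show "K_below a \<subseteq> carrier K" using Q_carrier by (auto simp: K_below_def)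
  show "K_below a \<noteq> {}" using subgroup.one_closed[OF subgroup_Q[of 0 a]] unfolding K_below_def by blast
  fix v assume "v \<in> K_below a"
  then obtain N where v: "v \<in> Q N a" by (auto simp: K_below_def)
  then show "inverse_word v \<in> K_below a"
    using subgroup.m_inv_closed[OF subgroup_Q] by (auto simp: K_below_def)
  fix w assume "w \<in> K_below a"
  then obtain M where w: "w \<in> Q M a" by (auto simp: K_below_def)
  have "v \<cdot> w \<in> Q (max N M) a"
    using v w Q_mono_le[of N "max N M" a] Q_mono_le[of M "max N M" a]
    by (intro subgroup.m_closed[OF subgroup_Q]) auto
  then show "v \<cdot> w \<in> K_below a" by (auto simp: K_below_def)
qed

lemma carrier_W:
  assumes "w \<in> carrier K"
  obtains N where "w \<in> W N"
proof -
  obtain N where "\<forall>n\<in>(\<lambda>l. rk (fst l)) ` set w. n < N"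
    using finite_nat_set_iff_bounded[THEN iffD1, OF finite_imageI[OF finite_set]] by blast
  then have "w \<in> W N" using assms by (auto simp: W_iff)
  then show thesis by (rule that)
qed

text \<open>This is the element written \<open>c w\<close> for words in the overview. The choice is
  unique, being the least \<open>a\<close> with \<open>w\<close> in
  \<open>K_below a\<close>.\<close>

definition least_label :: "('j \<times> 'a) list \<Rightarrow> 'i"
  where "least_label w = (SOME d. compact_element d \<and> (\<forall>a. w \<in> K_below a \<longleftrightarrow> d \<le> a))"

lemma least_label:
  assumes "w \<in> carrier K"
  shows "compact_element (least_label w)" "w \<in> K_below a \<longleftrightarrow> least_label w \<le> a"
proof -
  obtain N where N: "w \<in> W N" using carrier_W[OF assms] .
  have "\<exists>d. compact_element d \<and> (\<forall>a. w \<in> K_below a \<longleftrightarrow> d \<le> a)"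
    unfolding K_below_W[OF N] using level_ok_all[of N] N unfolding level_ok_def by blast
  from someI_ex[OF this] show "compact_element (least_label w)" "w \<in> K_below a \<longleftrightarrow> least_label w \<le> a"
    unfolding least_label_def[symmetric] by blast+
qed

text \<open>A block has at least five letters, so a single letter can only be read as
  itself.\<close>

lemma letter_K_below:
  assumes "j \<in> J" "x \<in> carrier \<Lambda>" "x \<noteq> \<one>\<^bsub>\<Lambda>\<^esub>"
  shows "[(j, x)] \<in> K_below a \<longleftrightarrow> c j \<le> a"
proof
  assume "c j \<le> a"
  then show "[(j, x)] \<in> K_below a"
    using assms Q_letter[of j "Suc (rk j)" a] by (intro Q_K_below[of _ "Suc (rk j)"]) (auto simp: fp_factor_iff)
next
  assume "[(j, x)] \<in> K_below a"
  moreover have "[(j, x)] \<in> W (Suc (rk j))" using assms by (simp add: W_iff letter_carrier)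
  ultimately have "[] @ (j, x) # [] \<in> Q (Suc (rk j)) a" using K_below_W by simp
  then show "c j \<le> a" using W_Nil refl
  proof (cases rule: Q_Suc_high[OF level_ok_all, consumes 3])
    case (2 t y z)
    then show ?thesis by (simp add: block_def)
  qed
qed

text \<open>Used to realise the join of two labels by one word. Two letters are too few for a block;
  the word is cut at its first letter of maximal rank, which is \<open>i\<close> or
  \<open>j\<close>.\<close>

lemma two_letters_K_below:
  assumes "[(i, x), (j, y)] \<in> carrier K"
  shows "[(i, x), (j, y)] \<in> K_below a \<longleftrightarrow> c i \<le> a \<and> c j \<le> a"
proof -
  have ij: "i \<in> J" "j \<in> J" "i \<noteq> j" "x \<in> carrier \<Lambda>" "x \<noteq> \<one>\<^bsub>\<Lambda>\<^esub>" "y \<in> carrier \<Lambda>" "y \<noteq> \<one>\<^bsub>\<Lambda>\<^esub>"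
    using assms by (auto simp: Cons_carrier)
  show ?thesis
  proof
    assume "c i \<le> a \<and> c j \<le> a"
    then have "[(i, x)] \<cdot> [(j, y)] \<in> K_below a"
      using ij letter_K_below by (intro subgroup.m_closed[OF subgroup_K_below]) auto
    then show "[(i, x), (j, y)] \<in> K_below a" using mul_append[of "[(i, x)]" "[(j, y)]"] assms by simp
  next
    assume h: "[(i, x), (j, y)] \<in> K_below a"
    have long: "[(j', y')] \<noteq> block t x' @ z" "[(i', y'), (j', y'')] \<noteq> block t x' @ z" for i' j' x' y' y'' t z
      by (auto simp: block_def dest: arg_cong[where f = length])
    define N where "N = max (rk i) (rk j)"
    have *: "[(i, x), (j, y)] \<in> Q (Suc N) a"
      using h assms by (subst K_below_W[symmetric]) (auto simp: W_iff N_def)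
    show "c i \<le> a \<and> c j \<le> a"
    proof (cases "rk i = N")
      case True
      have "[] @ (i, x) # [(j, y)] \<in> Q (Suc N) a" using * by simp
      then show ?thesis using W_Nil True
      proof (cases rule: Q_Suc_high[OF level_ok_all, consumes 3])
        case 1
        then show ?thesis using letter_K_below[of j y a] ij Q_K_below by blast
      qed (use long in blast)
    next
      case False
      then have rk: "rk i < N" "rk j = N" by (auto simp: N_def)
      have "[(i, x)] @ (j, y) # [] \<in> Q (Suc N) a" "[(i, x)] \<in> W N"
        using * ij rk by (auto simp: W_iff letter_carrier)
      then show ?thesis using rk(2)
      proof (cases rule: Q_Suc_high[OF level_ok_all, consumes 3])
        case 1
        then show ?thesis using letter_K_below[of i x a] ij Q_K_below by blast
      qed (use long in blast)
    qed
  qed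
qed

section \<open>Free bases of the subgroups \<open>K_below a\<close>\<close>

lemma basis_mono_le: "N \<le> M \<Longrightarrow> basis N a \<subseteq> basis M a"
  by (rule lift_Suc_mono_le[of "\<lambda>N. basis N a"]) (rule basis_mono)

definition full_basis :: "'i \<Rightarrow> ('j + 'j) set"
  where "full_basis a = (\<Union>N. basis N a)"

lemma fam_words_full_basis:
  assumes "V \<in> fam_words (full_basis a)"
  shows "\<exists>N. V \<in> fam_words (basis N a)"
  using assms
proof (induction V)
  case (Cons l V)
  obtain f s where l: "l = (f, s)" by (cases l)
  have f: "f \<in> full_basis a" "s \<in> fam f" "s \<noteq> []" "V \<in> fam_words (full_basis a)"
    "V = [] \<or> fst (hd V) \<noteq> f"
    using Cons.prems l by (auto simp: fam_words_Cons simp del: fam.simps)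
  obtain N M where "V \<in> fam_words (basis N a)" "f \<in> basis M a"
    using Cons.IH f by (auto simp: full_basis_def)
  moreover have "basis N a \<subseteq> basis (max N M) a" "basis M a \<subseteq> basis (max N M) a"
    by (rule basis_mono_le, simp)+
  ultimately have "V \<in> fam_words (basis (max N M) a)" "f \<in> basis (max N M) a"
    using fam_words_mono by blast+
  then show ?case using f l by (intro exI[of _ "max N M"]) (simp add: fam_words_Cons del: fam.simps)
qed simp

text \<open>A word over \<open>full_basis a\<close> has finitely many factors, so it is a word over
  the basis of some level, where freeness is known.\<close>

lemma freely_generated_K_below:
  "freely_generated_by (K\<lparr>carrier := K_below a\<rparr>) (fam ` full_basis a) (\<lambda>A. A)"
proof (rule K.freely_generated_by_image, fold eval_word_def)
  show sub: "subgroup (fam f) K" if "f \<in> full_basis a" for f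
    using that subgroup_basis by (auto simp: full_basis_def)
  show "fam f \<noteq> {\<one>\<^bsub>K\<^esub>}" if f: "f \<in> full_basis a" for f
  proof (cases f)
    case (Inl j)
    then show ?thesis using sigma by (auto simp: fp_factor_iff set_eq_iff)
  next
    case (Inr t)
    then have "valid t" using f by (auto simp: full_basis_def)
    note vt = validD[OF this]
    have b: "[(b t, \<sigma>)] \<in> fp_factor grp (b t)" "[(b t, \<sigma>)] \<in> carrier K"
      using sigma vt by (auto simp: fp_factor_iff letter_carrier)
    have "cnj t \<cdot> [(b t, \<sigma>)] \<cdot> inverse_word (cnj t) \<noteq> []"
    proof
      assume "cnj t \<cdot> [(b t, \<sigma>)] \<cdot> inverse_word (cnj t) = []"
      then have "cnj t \<cdot> [(b t, \<sigma>)] = cnj t"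
        using vt(7) b K.inv_equality[of "cnj t \<cdot> [(b t, \<sigma>)]" "inverse_word (cnj t)"] by simp
      then show False using vt(7) b K.l_cancel_one[of "cnj t" "[(b t, \<sigma>)]"] by simp
    qed
    then show ?thesis using b Inr by (auto simp: conjugate_set_image)
  qed
  show "V = []" if "V \<in> fam_words (full_basis a)" "eval_word V = \<one>\<^bsub>K\<^esub>" for V
    using fam_words_full_basis[OF that(1)] eval_word_eq_Nil[OF level_ok_all] that(2) unfolding one_K by blast
  show "eval_word ` fam_words (full_basis a) = K_below a"
  proof
    show "eval_word ` fam_words (full_basis a) \<subseteq> K_below a"
      using fam_words_full_basis[of _ a] eval_word_Q[OF level_ok_all] Q_K_below by blast
    have "fam_words (basis N a) \<subseteq> fam_words (full_basis a)" for N
      by (intro fam_words_mono) (auto simp: full_basis_def)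
    moreover have "Q N a = eval_word ` fam_words (basis N a)" for N
      using level_ok_all[of N] unfolding level_ok_def by blast
    ultimately show "K_below a \<subseteq> eval_word ` fam_words (full_basis a)"
      unfolding K_below_def by blast
  qed
qed (rule subgroup_K_below)

lemma fam_conjugate:
  assumes "f \<in> full_basis a"
  shows "\<exists>v\<in>carrier K. \<exists>j\<in>J. fam f = conjugate_set K v (fp_factor grp j)"
proof (cases f)
  case (Inl j)
  then have "j \<in> J" using assms by (auto simp: full_basis_def)
  moreover have "fam f = conjugate_set K [] (fp_factor grp j)"
  proof -
    have "[] \<cdot> s \<cdot> inverse_word [] = s" if "s \<in> fp_factor grp j" for s
      using K.inv_one subgroup.mem_carrier[OF subgroup_factor[OF \<open>j \<in> J\<close>] that] by simp
    then show ?thesis using Inl by (simp add: conjugate_set_image)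
  qed
  ultimately show ?thesis by (intro bexI[of _ "[]"] bexI[of _ j]) auto
next
  case (Inr t)
  then have "valid t" using assms by (auto simp: full_basis_def)
  then show ?thesis using Inr validD[of t] by (intro bexI[of _ "cnj t"] bexI[of _ "b t"]) auto
qed

end

section \<open>Intermediate subgroups when every pair of a word and a letter is treated\<close>

locale universal_labelled_free_product = labelled_free_product \<Lambda> J c rk T p g b \<sigma>
  for \<Lambda> :: "('a, 'b) monoid_scheme" and J :: "'j set" and c :: "'j \<Rightarrow> 'i::complete_lattice"
    and rk T p g b \<sigma> +
  assumes c_onto: "\<And>d. compact_element d \<Longrightarrow> \<exists>j\<in>J. c j = d"
    and T_onto: "\<And>w j. w \<in> reduced_words J (\<lambda>_. \<Lambda>) \<Longrightarrow> j \<in> J \<Longrightarrow>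
      \<exists>t\<in>T. g t = w \<and> b t = j \<and> rk j < rk t \<and> (\<forall>l\<in>set w. rk (fst l) < rk t)"
begin

lemma T_onto':
  assumes "w \<in> carrier K" "j \<in> J"
  obtains t where "t \<in> T" "g t = w" "b t = j" "w \<in> W (rk t)" "admissible t"
proof -
  obtain t where t: "t \<in> T" "g t = w" "b t = j" "rk j < rk t" "\<forall>l\<in>set w. rk (fst l) < rk t"
    using T_onto[of w j] assms K_simps(1) by blast
  then have "w \<in> W (rk t)" using assms(1) by (simp add: W_iff)
  then show thesis using that[of t] t assms(2) by (simp add: admissible_def)
qed

text \<open>The bound on \<open>c j\<close> says exactly that a \<open>t\<close> chosen for the pair
  of \<open>w\<close> and \<open>j\<close> is valid. Its conjugate of the copy \<open>j\<close> then
  lies in \<open>K_below bot\<close>, its conjugator lies in \<open>L1\<close> along with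
  \<open>w\<close>, and conjugating back gives the copy.\<close>

lemma factor_in_intermediate:
  assumes L1: "subgroup L1 K" "K_below bot \<subseteq> L1" and w: "w \<in> L1" and j: "j \<in> J" "c j \<le> least_label w"
  shows "fp_factor grp j \<subseteq> L1"
proof
  have wK: "w \<in> carrier K" using subgroup.mem_carrier[OF L1(1) w] .
  obtain t where t: "t \<in> T" "g t = w" "b t = j" "w \<in> W (rk t)" "admissible t"
    using T_onto'[OF wK j(1)] .
  have "c j \<le> d" if "w \<in> Q (rk t) d" for d
    using order_trans[OF j(2)] least_label(2)[OF wK] Q_K_below[OF that] by simp
  then have v: "valid t" using t by (simp add: valid_def)
  have "[(t, \<sigma>)] \<in> L1" "[(p t, \<sigma>)] \<in> L1"
    using L1(2) letter_K_below[of t \<sigma> bot] letter_K_below[of "p t" \<sigma> bot] T_J[OF t(1)] c_T[OF t(1)] sigma by auto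
  then have u: "cnj t \<in> L1"
    unfolding cnj_def t(2) using w by (intro subgroup.m_closed[OF L1(1)] subgroup.m_inv_closed[OF L1(1)])
  fix h assume h: "h \<in> fp_factor grp j"
  have hK: "h \<in> carrier K" using subgroup.mem_carrier[OF subgroup_factor[OF j(1)] h] .
  let ?s = "cnj t \<cdot> h \<cdot> inverse_word (cnj t)"
  have "?s \<in> fam (Inr t)" using h t(3) by (auto simp: conjugate_set_image)
  then have s: "?s \<in> L1" using Q_Inr[OF v refl, of bot] L1(2) by (auto simp: K_below_def)
  have eq: "h = inverse_word (cnj t) \<cdot> ?s \<cdot> cnj t"
    using hK validD(7)[OF v] K.inv_solve_left[of h "cnj t" "cnj t \<cdot> h"] by (simp add: K.m_assoc)
  have "inverse_word (cnj t) \<cdot> ?s \<cdot> cnj t \<in> L1"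
    by (rule subgroup.m_closed[OF L1(1) subgroup.m_closed[OF L1(1) subgroup.m_inv_closed[OF L1(1) u] s] u])
  then show "h \<in> L1" unfolding eq[symmetric] .
qed

text \<open>The attached conjugates do not depend on \<open>a\<close> and already lie in
  \<open>K_below bot\<close>, so only the letters have to be checked.\<close>

lemma K_below_subset:
  assumes L1: "subgroup L1 K" "K_below bot \<subseteq> L1"
    and "\<And>j. j \<in> J \<Longrightarrow> c j \<le> a \<Longrightarrow> fp_factor grp j \<subseteq> L1"
  shows "K_below a \<subseteq> L1"
proof -
  have "Q N a \<subseteq> L1" for N
  proof (induction N)
    case 0
    then show ?case using subgroup.one_closed[OF L1(1)] by simp
  next
    case (Suc N)
    moreover have "fam (Inr t) \<subseteq> L1" if "t \<in> {t. valid t \<and> rk t = N}" for t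
      using that Q_Inr[of t N bot] L1(2) unfolding K_below_def by blast
    moreover have "fam (Inl j) \<subseteq> L1" if "j \<in> {j \<in> J. rk j = N \<and> c j \<le> a}" for j
      using that assms(3) by simp
    ultimately show ?case
      unfolding Q_Suc by (intro K.generate_subgroup_incl L1(1) Un_least UN_least) blast+
  qed
  then show ?thesis by (auto simp: K_below_def)
qed

lemma intermediate_eq_K_below:
  assumes L1: "subgroup L1 K" "K_below bot \<subseteq> L1"
  shows "\<exists>a. L1 = K_below a"
proof -
  have cK: "w \<in> carrier K" if "w \<in> L1" for w using subgroup.mem_carrier[OF L1(1) that] .
  \<comment> \<open>The product of \<open>w1\<close> and \<open>w2\<close> may have a smaller label
    through cancellation. They are replaced by letters with the same labels, which lie in
    \<open>L1\<close>; the word in these two letters has a label above both.\<close>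
  have join: "\<exists>w\<in>L1. sup (least_label w1) (least_label w2) \<le> least_label w" if w12: "w1 \<in> L1" "w2 \<in> L1" for w1 w2
  proof -
    obtain j1 j2 where j: "j1 \<in> J" "c j1 = least_label w1" "j2 \<in> J" "c j2 = least_label w2"
      using c_onto least_label(1)[OF cK] w12 by metis
    have in_L1: "[(j1, \<sigma>)] \<in> L1" "[(j2, \<sigma>)] \<in> L1"
      using factor_in_intermediate[OF L1, of w1 j1] factor_in_intermediate[OF L1, of w2 j2] w12 j sigma
      by (auto simp: fp_factor_iff)
    show ?thesis
    proof (cases "j1 = j2")
      case True
      have "[(j1, \<sigma>)] \<in> K_below (least_label [(j1, \<sigma>)])" using least_label(2)[OF cK[OF in_L1(1)]] by simp
      then have "c j1 \<le> least_label [(j1, \<sigma>)]" using letter_K_below j sigma by simp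
      then show ?thesis using True j in_L1 by (intro bexI[of _ "[(j1, \<sigma>)]"]) auto
    next
      case False
      let ?w = "[(j1, \<sigma>), (j2, \<sigma>)]"
      have w: "?w \<in> carrier K" using j sigma False by (simp add: Cons_carrier)
      have "[(j1, \<sigma>)] \<cdot> [(j2, \<sigma>)] = ?w" using w mul_append[of "[(j1, \<sigma>)]" "[(j2, \<sigma>)]"] by simp
      then have "?w \<in> L1" using subgroup.m_closed[OF L1(1) in_L1] by simp
      moreover have "?w \<in> K_below (least_label ?w)" using least_label(2)[OF w] by simp
      ultimately show ?thesis using two_letters_K_below[OF w] j by (intro bexI[of _ ?w]) auto
    qed
  qed
  have fin: "\<exists>w\<in>L1. Sup F \<le> least_label w" if "finite F" "F \<subseteq> least_label ` L1" for F
    using that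
  proof (induction F rule: finite_induct)
    case empty
    then show ?case using subgroup.one_closed[OF L1(1)] by auto
  next
    case (insert d F)
    then obtain w1 w2 where w: "w1 \<in> L1" "Sup F \<le> least_label w1" "w2 \<in> L1" "d = least_label w2" by auto
    obtain w where "w \<in> L1" "sup (least_label w2) (least_label w1) \<le> least_label w" using join[OF w(3,1)] by metis
    moreover have "Sup (insert d F) \<le> sup (least_label w2) (least_label w1)"
      using w by (simp add: le_supI2)
    ultimately show ?case using order_trans by metis
  qed
  \<comment> \<open>The labels of \<open>L1\<close> are directed, so compactness of
    \<open>c j\<close> bounds it by a single label once it lies below their supremum.\<close>
  define a where "a = Sup (least_label ` L1)"
  have "L1 \<subseteq> K_below a"
    using least_label(2)[OF cK] by (auto simp: a_def intro: Sup_upper)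
  moreover have "K_below a \<subseteq> L1"
  proof (rule K_below_subset[OF L1])
    fix j assume j: "j \<in> J" "c j \<le> a"
    \<comment> \<open>Compactness is stated for nonempty sets only.\<close>
    have "least_label ` L1 \<noteq> {}" using subgroup.one_closed[OF L1(1)] by blast
    then have "\<exists>F\<subseteq>least_label ` L1. finite F \<and> c j \<le> Sup F"
      using compact_c[OF j(1)] j(2) unfolding compact_element_def a_def by simp
    then obtain F where F: "finite F" "F \<subseteq> least_label ` L1" "c j \<le> Sup F" by metis
    obtain w where w: "w \<in> L1" "Sup F \<le> least_label w" using fin[OF F(1,2)] by metis
    show "fp_factor grp j \<subseteq> L1"
      by (rule factor_in_intermediate[OF L1 w(1) j(1) order_trans[OF F(3) w(2)]])
  qed
  ultimately show ?thesis by blast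
qed

lemma K_below_mono:
  assumes "a \<le> d"
  shows "K_below a \<subseteq> K_below d"
proof
  fix w assume w: "w \<in> K_below a"
  have "w \<in> carrier K" using subgroup.mem_carrier[OF subgroup_K_below w] .
  then show "w \<in> K_below d" using least_label(2) w order_trans[OF _ assms] by simp
qed

text \<open>Algebraicity enters here: \<open>a\<close> is a supremum of compact elements, each of
  them is the label of a letter, and single letters detect their labels.\<close>

lemma K_below_subset_iff:
  assumes "algebraic_lattice TYPE('i)"
  shows "K_below a \<subseteq> K_below d \<longleftrightarrow> a \<le> d"
proof
  assume sub: "K_below a \<subseteq> K_below d"
  obtain C where C: "\<forall>x\<in>C. compact_element x" "a = Sup C"
    using assms unfolding algebraic_lattice_def by blast
  have "x \<le> d" if xC: "x \<in> C" for x
  proof -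
    obtain j where j: "j \<in> J" "c j = x" using c_onto[of x] C(1) xC by blast
    have "c j \<le> a" unfolding C(2) j(2) using xC by (rule Sup_upper)
    then have "[(j, \<sigma>)] \<in> K_below a" using letter_K_below[OF j(1) sigma] by simp
    then have "[(j, \<sigma>)] \<in> K_below d" using sub by (rule subsetD[rotated])
    then show ?thesis using letter_K_below[OF j(1) sigma] j(2) by simp
  qed
  then show "a \<le> d" unfolding C(2) by (rule Sup_least)
qed (rule K_below_mono)

text \<open>The join is itself some \<open>K_below a\<close>. It contains the conjugate by
  \<open>v\<close> of a letter whose rank exceeds all ranks in \<open>v\<close>, and reading that
  word forces \<open>v\<close> into the join.\<close>

lemma mem_conjugate_join:
  assumes v: "v \<in> carrier K"
  shows "v \<in> generate K (K_below bot \<union> conjugate_set K v (K_below bot))"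
proof -
  let ?M = "generate K (K_below bot \<union> conjugate_set K v (K_below bot))"
  have "conjugate_set K v (K_below bot) \<subseteq> carrier K"
    using subgroup.subset[OF K.subgroup_conjugate_set[OF v subgroup_K_below]] .
  then have M: "subgroup ?M K"
    using subgroup.subset[OF subgroup_K_below] by (intro K.generate_is_subgroup) blast
  have incl: "K_below bot \<subseteq> ?M" "conjugate_set K v (K_below bot) \<subseteq> ?M" by (auto intro: generate.incl)
  then obtain a where a: "?M = K_below a" using intermediate_eq_K_below M by blast
  \<comment> \<open>Any \<open>j\<close> will do: only the partner \<open>p t\<close> is wanted, a
    letter of label \<open>bot\<close> and of rank above the letters of \<open>v\<close>.\<close>
  obtain j where "j \<in> J" using c_onto compact_element_bot by blast
  then obtain t where t: "t \<in> T" "g t = v" "v \<in> W (rk t)" using T_onto' v by metis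
  let ?N = "rk t" and ?w = "v @ (p t, \<sigma>) # inverse_word v"
  have iv: "inverse_word v \<in> W ?N" using t W_inv by blast
  have wK: "?w \<in> carrier K"
    using t iv v sigma T_J[OF t(1)] rk_p[OF t(1)] low_not_letter[OF t(3), of "p t"] low_not_letter[OF iv, of "p t"]
    by (auto simp: append_carrier Cons_carrier)
  then have "?w = v \<cdot> ([(p t, \<sigma>)] \<cdot> inverse_word v)"
    using mul_append[of v "(p t, \<sigma>) # inverse_word v"] mul_append[of "[(p t, \<sigma>)]" "inverse_word v"]
    by (simp add: append_carrier)
  also have "\<dots> = v \<cdot> [(p t, \<sigma>)] \<cdot> inverse_word v"
    using v sigma_letters[OF t(1)] by (simp add: K.m_assoc)
  also have "\<dots> \<in> conjugate_set K v (K_below bot)"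
    using letter_K_below[of "p t" \<sigma> bot] T_J[OF t(1)] c_T[OF t(1)] sigma by (auto simp: conjugate_set_image)
  finally have "?w \<in> K_below a" using incl a by blast
  moreover have "?w \<in> W (Suc ?N)"
    using wK t(3) iv rk_p[OF t(1)] by (auto simp: W_iff)
  ultimately have "?w \<in> Q (Suc ?N) a" using K_below_W by blast
  \<comment> \<open>The first letter of rank \<open>?N\<close> is \<open>p t\<close>. It lies
    outside \<open>T\<close> and starts no block, so it is a factor of its own and the prefix
    \<open>v\<close> is in \<open>Q ?N a\<close>.\<close>
  then have "v \<in> Q ?N a"
    using t(3) rk_p[OF t(1)]
  proof (cases rule: Q_Suc_high[OF level_ok_all, consumes 3])
    case (2 t' x z)
    then show ?thesis using p_notin_T[OF t(1)] validD(2)[OF 2(1)] by (simp add: block_def)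
  qed
  then show ?thesis unfolding a by (auto simp: K_below_def)
qed

end

section \<open>Encoding the free product\<close>

text \<open>\<open>J\<close> is cut into countably many copies of itself. Copy 0 carries the labels,
  copy \<open>2 * m + 1\<close> the letters of \<open>T\<close>, and copy \<open>2 * m + 2\<close>
  their partners.\<close>

lemma ex_universal_labelled_free_product:
  fixes J :: "'j set" and \<Lambda> :: "('a, 'b) monoid_scheme"
  assumes J: "has_max_card J {a::'i::complete_lattice. compact_element a} (UNIV :: nat set)"
    and gr: "group \<Lambda>" and count: "countable (carrier \<Lambda>)" and nontriv: "carrier \<Lambda> \<noteq> {\<one>\<^bsub>\<Lambda>\<^esub>}"
  shows "\<exists>(c :: 'j \<Rightarrow> 'i) rk T p g b \<sigma>. universal_labelled_free_product \<Lambda> J c rk T p g b \<sigma>"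
proof -
  interpret group \<Lambda> by (rule gr)
  obtain \<sigma> where \<sigma>: "\<sigma> \<in> carrier \<Lambda>" "\<sigma> \<noteq> \<one>\<^bsub>\<Lambda>\<^esub>" using nontriv by blast
  have inf: "infinite J" and comp: "{a::'i. compact_element a} \<lesssim> J"
    using has_max_card_nat[OF J] by auto
  have nat_J: "(UNIV :: nat set) \<lesssim> J" using inf infinite_le_lepoll by blast
  have "J \<lesssim> (UNIV :: nat set) \<times> J"
    unfolding lepoll_def by (intro exI[of _ "Pair 0"]) (auto simp: inj_on_def)
  then have "J \<approx> (UNIV :: nat set) \<times> J"
    using infinite_times_lepoll_self[OF inf nat_J] by (rule lepoll_antisym)
  then obtain \<beta> where \<beta>: "bij_betw \<beta> J ((UNIV :: nat set) \<times> J)" unfolding eqpoll_def by blast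
  define \<delta> where "\<delta> = inv_into J \<beta>"
  have \<delta>: "\<delta> (n, i) \<in> J" "\<beta> (\<delta> (n, i)) = (n, i)" if "i \<in> J" for n i
    using that \<beta> by (auto simp: \<delta>_def bij_betw_def inv_into_into f_inv_into_f)
  have snd_\<beta>: "snd (\<beta> j) \<in> J" if "j \<in> J" for j
    using bij_betwE[OF \<beta>] that by (metis SigmaE snd_conv)
  have "reduced_words J (\<lambda>_. \<Lambda>) \<times> J \<lesssim> J"
    by (rule infinite_times_lepoll_self[OF inf reduced_words_lepoll[OF inf count]])
  then obtain s where s: "reduced_words J (\<lambda>_. \<Lambda>) \<times> J \<subseteq> s ` J" unfolding lepoll_iff by blast
  obtain f where f: "{a::'i. compact_element a} \<subseteq> f ` J" using comp unfolding lepoll_iff by blast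
  \<comment> \<open>\<open>f\<close> may take values that are not compact, so \<open>bot\<close> is
    the default in copy 0 as well as the label in all other copies.\<close>
  define c where "c j = (if fst (\<beta> j) = 0 \<and> compact_element (f (snd (\<beta> j))) then f (snd (\<beta> j)) else bot)" for j
  \<comment> \<open>Copies \<open>2 * m + 1\<close> and \<open>2 * m + 2\<close> share rank
    \<open>m + 1\<close>, so partners have equal rank; copy 0 has rank 0.\<close>
  define rk where "rk j = Suc (fst (\<beta> j)) div 2" for j
  define T where "T = {j \<in> J. odd (fst (\<beta> j))}"
  define p where "p j = \<delta> (Suc (fst (\<beta> j)), snd (\<beta> j))" for j
  define g where "g j = fst (s (snd (\<beta> j)))" for j
  define b where "b j = snd (s (snd (\<beta> j)))" for j
  have p: "p t \<in> J" "\<beta> (p t) = (Suc (fst (\<beta> t)), snd (\<beta> t))" if "t \<in> T" for t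
    using that \<delta> snd_\<beta> by (auto simp: p_def T_def)
  have "universal_labelled_free_product \<Lambda> J c rk T p g b \<sigma>"
  proof
    show "compact_element (c j)" for j by (simp add: c_def compact_element_bot)
    show "t \<in> J" if "t \<in> T" for t using that by (simp add: T_def)
    show "p t \<in> J" if "t \<in> T" for t using p that by blast
    show "p t \<notin> T" if "t \<in> T" for t using p[OF that] that by (simp add: T_def)
    show "rk (p t) = rk t" if "t \<in> T" for t
      using p[OF that] that by (auto simp: T_def rk_def elim!: oddE)
    show "c t = bot" if "t \<in> T" for t using that by (auto simp: T_def c_def)
    show "c (p t) = bot" if "t \<in> T" for t using p[OF that] by (simp add: c_def)
    show "\<exists>j\<in>J. c j = d" if d: "compact_element d" for d
    proof -
      obtain i where i: "i \<in> J" "d = f i" using f d by blast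
      then show ?thesis using \<delta>[OF i(1), of 0] d by (intro bexI[of _ "\<delta> (0, i)"]) (auto simp: c_def)
    qed
    show "\<exists>t\<in>T. g t = w \<and> b t = j \<and> rk j < rk t \<and> (\<forall>l\<in>set w. rk (fst l) < rk t)"
      if wj: "w \<in> reduced_words J (\<lambda>_. \<Lambda>)" "j \<in> J" for w j
    proof -
      obtain i where i: "i \<in> J" "s i = (w, j)" using subsetD[OF s SigmaI[OF wj]] by auto
      obtain m where m: "\<forall>n\<in>insert (rk j) ((\<lambda>l. rk (fst l)) ` set w). n < m"
        using finite_nat_set_iff_bounded[THEN iffD1, OF finite.insertI[OF finite_imageI[OF finite_set]]] by blast
      \<comment> \<open>Every odd copy runs through all pairs again, so the given pair recurs at a
        rank above any bound.\<close>
      let ?t = "\<delta> (2 * m + 1, i)"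
      have "?t \<in> T" "g ?t = w" "b ?t = j" "rk ?t = Suc m"
        using \<delta>[OF i(1), of "2 * m + 1"] i(2) by (auto simp: T_def g_def b_def rk_def)
      then show ?thesis using m by (intro bexI[of _ ?t]) auto
    qed
  qed (use \<sigma> in auto)
  then show ?thesis by blast
qed

section \<open>The three properties for the subgroup \<open>K_below bot\<close>\<close>

theorem theorem9p1:
  fixes J :: "'j set"
    and \<Lambda> :: "('a, 'b) monoid_scheme"
    and K :: "('j \<times> 'a) list monoid"
  assumes "algebraic_lattice TYPE('i::complete_lattice)"
    and "has_max_card J {a::'i. compact_element a} (UNIV :: nat set)"
    and "group \<Lambda>" and "countable (carrier \<Lambda>)" and "carrier \<Lambda> \<noteq> {\<one>\<^bsub>\<Lambda>\<^esub>}"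
    and "K = free_product J (\<lambda>_. \<Lambda>)"
  shows "\<exists>L. subgroup L K \<and>
    (\<exists>\<phi> :: 'i \<Rightarrow> ('j \<times> 'a) list set.
       bij_betw \<phi> UNIV (intermediate_subgroups K L) \<and> (\<forall>a b. a \<le> b \<longleftrightarrow> \<phi> a \<subseteq> \<phi> b)) \<and>
    (\<forall>L\<^sub>1 \<in> intermediate_subgroups K L.
       \<exists>\<H>. (\<forall>H\<in>\<H>. \<exists>g\<in>carrier K. \<exists>j\<in>J. H = conjugate_set K g (fp_factor (\<lambda>_. \<Lambda>) j)) \<and>
            freely_generated_by (K\<lparr>carrier := L\<^sub>1\<rparr>) \<H> (\<lambda>H. H)) \<and>
    (\<forall>g\<in>carrier K. g \<in> generate K (L \<union> conjugate_set K g L))"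
proof -
  obtain c :: "'j \<Rightarrow> 'i" and rk T p g b \<sigma> where "universal_labelled_free_product \<Lambda> J c rk T p g b \<sigma>"
    using ex_universal_labelled_free_product[OF assms(2-5)] by blast
  then interpret U: universal_labelled_free_product \<Lambda> J c rk T p g b \<sigma> .
  have K: "K = U.K" using assms(6) by (simp add: U.K_def)
  have inter: "intermediate_subgroups K (U.K_below bot) = range U.K_below"
  proof (intro equalityI subsetI)
    fix L1 assume "L1 \<in> intermediate_subgroups K (U.K_below bot)"
    then have "subgroup L1 U.K" "U.K_below bot \<subseteq> L1" by (simp_all add: intermediate_subgroups_def K)
    then show "L1 \<in> range U.K_below" using U.intermediate_eq_K_below[of L1] by auto
  next
    fix L1 assume "L1 \<in> range U.K_below"
    then obtain a where "L1 = U.K_below a" by auto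
    then show "L1 \<in> intermediate_subgroups K (U.K_below bot)"
      using U.subgroup_K_below[of a] U.K_below_mono[OF bot_least, of a] by (simp add: intermediate_subgroups_def K)
  qed
  have "inj U.K_below"
  proof (rule injI)
    fix x y assume "U.K_below x = U.K_below y"
    then show "x = y"
      using U.K_below_subset_iff[OF assms(1), of x y] U.K_below_subset_iff[OF assms(1), of y x] by simp
  qed
  then have "bij_betw U.K_below UNIV (intermediate_subgroups K (U.K_below bot))"
    unfolding inter by (simp add: bij_betw_def)
  moreover have "\<exists>\<H>. (\<forall>H\<in>\<H>. \<exists>g\<in>carrier K. \<exists>j\<in>J. H = conjugate_set K g (fp_factor (\<lambda>_. \<Lambda>) j)) \<and>
      freely_generated_by (K\<lparr>carrier := L\<^sub>1\<rparr>) \<H> (\<lambda>H. H)"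
    if L1: "L\<^sub>1 \<in> intermediate_subgroups K (U.K_below bot)" for L\<^sub>1
  proof -
    obtain a where a: "L\<^sub>1 = U.K_below a" using L1 unfolding inter by blast
    show ?thesis
      unfolding K a using U.freely_generated_K_below[of a] U.fam_conjugate[of _ a]
      by (intro exI[of _ "U.fam ` U.full_basis a"]) simp
  qed
  ultimately show ?thesis
    using U.K_below_subset_iff[OF assms(1)] U.subgroup_K_below[of bot] U.mem_conjugate_join
    unfolding K by (intro exI[of _ "U.K_below bot"] conjI exI[of _ U.K_below] ballI allI) simp_all
qed

end
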